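(* Let $(m_n)$ be a sequence of positive integers with $m_n/n\to\alpha\in(0,\infty)$ as $n\to\infty$, and suppose that either (i) $m_n$ is even for all $n$; or (ii) $\mathbb{P}[W\in 2\mathbb{Z}]>0$. Then $$\lim_{n\to\infty}n^{-1}\log\mathbb{P}[A(n,m_n)]=-R_\rho(\alpha),$$ where $R_\rho(\alpha)>0$ is continuous and nondecreasing in $\alpha>0$ and is defined by $$R_\rho(\alpha):=-\log\sup_{\gamma\in[0,1/2]}\left(\frac{(\rho(1-2\gamma))^\alpha}{2\gamma^\gamma(1-\gamma)^{1-\gamma}}\right).$$
   Context: Convention: $0^0:=1$. Let $W$ be an $\mathbb{N}$-valued random variable ($\mathbb{N}=\{1,2,\ldots\}$) with $\rho(s):=\mathbb{E}[s^W]$. For each $n\in\mathbb{N}$ let $W_n$ be a random variable with values in $\{1,\ldots,n\}$, such that $W_n\to W$ in distribution as $n\to\infty$. For each $n$, let $X_1,X_2,\ldots$ be i.i.d. random vectors in $\{0,1\}^n$, each having weight (number of ones) distributed as $W_n$ and, conditionally on its weight being $k$, uniformly distributed over the vectors in $\{0,1\}^n$ of weight $k$. $A(n,m)$ denotes the event $\{X_1+\cdots+X_m\equiv\mathbf{0}\ (\mathrm{mod}\ 2)\}$. *)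

theory Defs
  imports "HOL-Probability.Probability" "HOL-Number_Theory.Cong"
begin

text \<open>Real powers with the convention \<open>0^0 = 1\<close>; note that \<open>0 powr 0 = 0\<close> in the library.\<close>

definition rpow :: "real \<Rightarrow> real \<Rightarrow> real" where
  "rpow x y = (if x = 0 \<and> y = 0 then 1 else x powr y)"

definition rho :: "nat pmf \<Rightarrow> real \<Rightarrow> real" where
  "rho W s = measure_pmf.expectation W (\<lambda>k. s ^ k)"

definition rate :: "nat pmf \<Rightarrow> real \<Rightarrow> real" where
  "rate W \<alpha> = - ln (SUP \<gamma>\<in>{0..1/2}.
     rpow (rho W (1 - 2 * \<gamma>)) \<alpha> / (2 * rpow \<gamma> \<gamma> * rpow (1 - \<gamma>) (1 - \<gamma>)))"

text \<open>The vectors in \<open>{0,1}^n\<close>, as functions on the coordinates \<open>1, \<dots>, n\<close>.\<close>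

definition binary_vectors :: "nat \<Rightarrow> (nat \<Rightarrow> nat) set" where
  "binary_vectors n = {1..n} \<rightarrow>\<^sub>E {0, 1}"

definition weight :: "nat \<Rightarrow> (nat \<Rightarrow> nat) \<Rightarrow> nat" where
  "weight n x = card {j \<in> {1..n}. x j = 1}"

text \<open>\<open>X 1, X 2, \<dots>\<close> are independent random vectors in \<open>{0,1}^n\<close> on the probability space \<open>M\<close>,
  each with weight distributed as \<open>w\<close> and conditionally uniform given its weight. The last two
  conditions determine the law of \<open>X i\<close>, so that the \<open>X i\<close> are identically distributed.\<close>

definition iid_weighted_vectors ::
    "nat \<Rightarrow> nat pmf \<Rightarrow> 'a measure \<Rightarrow> (nat \<Rightarrow> 'a \<Rightarrow> nat \<Rightarrow> nat) \<Rightarrow> bool" where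
  "iid_weighted_vectors n w M X \<longleftrightarrow>
     prob_space M \<and>
     prob_space.indep_vars M (\<lambda>_. count_space (binary_vectors n)) X {1..} \<and>
     (\<forall>i\<ge>1. distr M (count_space UNIV) (\<lambda>\<omega>. weight n (X i \<omega>)) = measure_pmf w) \<and>
     (\<forall>i\<ge>1. \<forall>k\<in>set_pmf w. \<forall>x\<in>binary_vectors n. weight n x = k \<longrightarrow>
        cond_prob M (\<lambda>\<omega>. X i \<omega> = x) (\<lambda>\<omega>. weight n (X i \<omega>) = k) =
          1 / card {y \<in> binary_vectors n. weight n y = k})"

definition zero_sum_event ::
    "nat \<Rightarrow> nat \<Rightarrow> 'a measure \<Rightarrow> (nat \<Rightarrow> 'a \<Rightarrow> nat \<Rightarrow> nat) \<Rightarrow> 'a set" where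
  "zero_sum_event n m M X =
     {\<omega> \<in> space M. \<forall>j\<in>{1..n}. [(\<Sum>i=1..m. X i \<omega> j) = 0] (mod 2)}"

end

theory Submission
  imports Defs "HOL-Real_Asymp.Real_Asymp"
begin

text \<open>By Fourier inversion on the group \<open>{0,1}\<^sup>n\<close>, the probability of \<open>A(n,m)\<close> is the mean over
  \<open>S \<subseteq> {1..n}\<close> of \<open>f(S)\<^sup>m\<close>, where \<open>f(S)\<close> is the expectation of the character of \<open>S\<close> under the law of
  one vector. Given weight \<open>k\<close>, this character is a product of \<open>k\<close> signs sampled without replacement,
  and sampling with replacement would give \<open>(1 - 2|S|/n)\<^sup>k\<close>; hence \<open>f(S)\<close> is close to
  \<open>\<rho>(1 - 2|S|/n)\<close>, uniformly in \<open>S\<close>. Each level \<open>|S| = \<gamma>n\<close> then contributes the \<open>n\<close>-th power of the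
  quotient in the definition of \<open>R\<^sub>\<rho>\<close>, up to a factor \<open>n + 1\<close> from the binomial coefficient, and
  levels beyond \<open>n/2\<close> are dominated because \<open>|\<rho>(-s)| \<le> \<rho>(s)\<close>. For the lower bound, \<open>S\<close> is paired
  with its complement: under the parity hypothesis the two contributions have a nonnegative sum, unless
  \<open>|S|\<close> is so close to \<open>n/2\<close> that they are negligible. Continuity holds because \<open>exp(-R\<^sub>\<rho>)\<close> is a
  supremum of convex functions of \<open>\<alpha>\<close>.\<close>

section \<open>Generating functions and entropy\<close>

lemma integrable_power_pmf:
  fixes W :: "nat pmf" and s :: real
  assumes "\<bar>s\<bar> \<le> 1"
  shows "integrable (measure_pmf W) (\<lambda>k. s ^ k)"
  using assms by (intro measure_pmf.integrable_const_bound[where B=1])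
    (auto simp: power_abs intro!: power_le_one)

lemma abs_rho_le_1:
  assumes "\<bar>s\<bar> \<le> 1"
  shows "\<bar>rho W s\<bar> \<le> 1"
proof -
  have "\<bar>rho W s\<bar> \<le> measure_pmf.expectation W (\<lambda>k. \<bar>s ^ k\<bar>)"
    unfolding rho_def by (rule integral_abs_bound)
  also have "\<dots> \<le> measure_pmf.expectation W (\<lambda>k. 1)"
    using integrable_power_pmf[of "\<bar>s\<bar>" W] assms
    by (intro integral_mono) (auto simp: power_abs intro!: power_le_one)
  finally show ?thesis by simp
qed

lemma rho_nonneg:
  assumes "0 \<le> s"
  shows "0 \<le> rho W s"
  unfolding rho_def using assms by (intro Bochner_Integration.integral_nonneg) auto

lemma abs_rho_le_rho_abs:
  assumes "\<bar>s\<bar> \<le> 1"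
  shows "\<bar>rho W s\<bar> \<le> rho W \<bar>s\<bar>"
  unfolding rho_def power_abs[symmetric] by (rule integral_abs_bound)

lemma rho_le_self:
  assumes "set_pmf W \<subseteq> {1..}" "0 \<le> s" "s \<le> 1"
  shows "rho W s \<le> s"
proof -
  have "AE k in measure_pmf W. s ^ k \<le> s"
    using assms power_decreasing[of 1 _ s] by (auto simp: AE_measure_pmf_iff)
  then have "rho W s \<le> measure_pmf.expectation W (\<lambda>k. s)"
    unfolding rho_def using integrable_power_pmf[of s W] assms
    by (intro integral_mono_AE) auto
  then show ?thesis by simp
qed

lemma rho_pos:
  assumes "0 < s" "s \<le> 1"
  shows "0 < rho W s"
proof -
  obtain k where k: "k \<in> set_pmf W" by (meson set_pmf_not_empty ex_in_conv)
  have "0 < pmf W k * s ^ k" using k assms by (simp add: pmf_positive)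
  also have "\<dots> = measure_pmf.expectation W (\<lambda>i. indicator {k} i * s ^ k)"
    by (simp add: measure_pmf_single)
  also have "\<dots> \<le> rho W s"
    unfolding rho_def using integrable_power_pmf[of s W] assms
    by (intro integral_mono) (auto simp: indicator_def intro!: measure_pmf.integrable_const_bound[where B=1] power_le_one)
  finally show ?thesis .
qed

text \<open>Odd powers cancel in \<open>s ^ i + (- s) ^ i\<close> and even powers double, so one
  even atom of \<open>W\<close> already bounds the sum from below. Parity hypothesis (ii) enters the
  proof here.\<close>

lemma rho_even_part_ge:
  assumes "0 \<le> s" "s \<le> 1" "even k"
  shows "2 * (pmf W k * s ^ k) \<le> rho W s + rho W (- s)"
proof -
  have i: "integrable (measure_pmf W) (\<lambda>k. s ^ k)" "integrable (measure_pmf W) (\<lambda>k. (- s) ^ k)"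
    using assms by (auto intro!: integrable_power_pmf)
  have "2 * (pmf W k * s ^ k) = measure_pmf.expectation W (\<lambda>i. indicator {k} i * (2 * s ^ k))"
    by (simp add: measure_pmf_single)
  also have "\<dots> \<le> measure_pmf.expectation W (\<lambda>i. s ^ i + (- s) ^ i)"
  proof (intro integral_mono)
    fix i
    show "indicator {k} i * (2 * s ^ k) \<le> s ^ i + (- s) ^ i"
      using assms by (cases "even i") (auto simp: indicator_def)
  qed (use assms i in \<open>auto simp: indicator_def abs_mult intro!: measure_pmf.integrable_const_bound[where B=2] power_le_one\<close>)
  also have "\<dots> = rho W s + rho W (- s)"
    unfolding rho_def by (rule Bochner_Integration.integral_add[OF i])
  finally show ?thesis .
qed

lemma continuous_on_rho: "continuous_on {-1..1} (rho W)"
proof (clarsimp simp: continuous_on_sequentially comp_def)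
  fix f :: "nat \<Rightarrow> real" and s
  assume f: "\<forall>n. - 1 \<le> f n \<and> f n \<le> 1" "f \<longlonglongrightarrow> s"
  then have "\<And>n. \<bar>f n\<bar> \<le> 1" by (auto simp: abs_le_iff minus_le_iff)
  then show "(\<lambda>n. rho W (f n)) \<longlonglongrightarrow> rho W s"
    unfolding rho_def using f(2)
    by (intro integral_dominated_convergence[where w="\<lambda>_. 1"])
      (auto intro!: tendsto_power simp: power_abs intro!: power_le_one)
qed

text \<open>This is exp(-H(x)), where H is the entropy (natural logarithm) of a coin with bias x; at
  both endpoints the convention for \<open>rpow\<close> gives 1.\<close>

definition self_pow :: "real \<Rightarrow> real" where
  "self_pow x = rpow x x * rpow (1 - x) (1 - x)"

lemma tendsto_rpow_self_0: "((\<lambda>x. rpow x x) \<longlongrightarrow> 1) (at_right 0)"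
proof -
  have "((\<lambda>x::real. x powr x) \<longlongrightarrow> 1) (at_right 0)" by real_asymp
  then show ?thesis
    by (rule Lim_transform_eventually) (auto simp: rpow_def eventually_at_filter)
qed

text \<open>The convention 0^0 = 1 is exactly what makes x^x continuous up to 0; with
  \<open>powr\<close> alone the value there would jump to 0.\<close>

lemma continuous_on_rpow_self: "continuous_on {0..} (\<lambda>x. rpow x x)"
proof (clarsimp simp: continuous_on_def)
  fix x :: real assume "0 \<le> x"
  show "((\<lambda>x. rpow x x) \<longlongrightarrow> rpow x x) (at x within {0..})"
  proof (cases "x = 0")
    case True
    have "((\<lambda>x. rpow x x) \<longlongrightarrow> 1) (at 0 within {0..})"
      using tendsto_rpow_self_0 by (simp add: at_within_Ici_at_right)
    then show ?thesis using True by (simp add: rpow_def)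
  next
    case False
    then have x: "0 < x" using \<open>0 \<le> x\<close> by simp
    have "((\<lambda>x. x powr x) \<longlongrightarrow> x powr x) (at x within {0..})"
      using x by (intro tendsto_intros) auto
    moreover have "eventually (\<lambda>y. y powr y = rpow y y) (at x within {0..})"
    proof -
      have "eventually (\<lambda>y. y \<noteq> 0) (at x within {0..})"
        using x by (intro t1_space_nhds eventually_at_topological[THEN iffD2] exI[of _ "{0<..}"]) auto
      then show ?thesis by eventually_elim (simp add: rpow_def)
    qed
    ultimately have "((\<lambda>x. rpow x x) \<longlongrightarrow> x powr x) (at x within {0..})"
      by (rule Lim_transform_eventually)
    then show ?thesis using x by (simp add: rpow_def)
  qed
qed

lemma continuous_on_self_pow: "continuous_on {0..1} self_pow"
  unfolding self_pow_def
  by (intro continuous_intros continuous_on_subset[OF continuous_on_rpow_self]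
      continuous_on_compose2[OF continuous_on_rpow_self, of _ "\<lambda>x. 1 - x"]) auto

lemma self_pow_eq_exp:
  assumes "0 < x" "x < 1"
  shows "self_pow x = exp (x * ln x + (1 - x) * ln (1 - x))"
  using assms by (simp add: self_pow_def rpow_def powr_def exp_add)

lemma self_pow_bounds:
  assumes "0 \<le> x" "x \<le> 1"
  shows "1/2 \<le> self_pow x" "self_pow x \<le> 1"
proof -
  have "1/2 \<le> self_pow x \<and> self_pow x \<le> 1"
  proof (cases "x = 0 \<or> x = 1")
    case True
    then show ?thesis by (auto simp: self_pow_def rpow_def)
  next
    case False
    then have x: "0 < x" "x < 1" using assms by auto
    \<comment> \<open>The bound ln t \<le> t - 1 at t = 1/(2y). Applied to y = x and y = 1 - x, the
      two right-hand sides cancel, which bounds the entropy by ln 2.\<close>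
    have *: "- (y * (ln 2 + ln y)) \<le> 1/2 - y" if "0 < y" for y :: real
    proof -
      have "ln (1 / (2 * y)) \<le> 1 / (2 * y) - 1" using that by (intro ln_le_minus_one) auto
      then have "y * ln (1 / (2 * y)) \<le> y * (1 / (2 * y) - 1)" using that by (intro mult_left_mono) auto
      moreover have "ln (1 / (2 * y)) = - (ln 2 + ln y)"
        using that by (simp add: ln_div ln_mult_pos)
      then have "y * ln (1 / (2 * y)) = - (y * (ln 2 + ln y))" by (simp only: mult_minus_right)
      moreover have "y * (1 / (2 * y) - 1) = 1/2 - y" using that by (simp add: right_diff_distrib)
      ultimately show ?thesis by linarith
    qed
    have "- ln 2 \<le> x * ln x + (1 - x) * ln (1 - x)"
      using *[of x] *[of "1 - x"] x by (simp add: algebra_simps)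
    then have "exp (- ln 2) \<le> self_pow x" using x by (simp add: self_pow_eq_exp)
    moreover have "x * ln x + (1 - x) * ln (1 - x) \<le> 0"
      using x by (intro add_nonpos_nonpos mult_nonneg_nonpos) auto
    ultimately show ?thesis using x by (simp add: self_pow_eq_exp exp_minus)
  qed
  then show "1/2 \<le> self_pow x" "self_pow x \<le> 1" by auto
qed

lemma self_pow_commute: "self_pow (1 - x) = self_pow x"
  by (simp add: self_pow_def)

section \<open>The rate function\<close>

text \<open>The quotient inside the rate. Ordinary \<open>powr\<close> replaces \<open>rpow\<close>
  for the power of \<open>rho\<close>, since the two differ only at exponent 0 and the exponents of
  interest are positive.\<close>

definition fibre_growth :: "nat pmf \<Rightarrow> real \<Rightarrow> real \<Rightarrow> real" where
  "fibre_growth W a \<gamma> = rho W (1 - 2 * \<gamma>) powr a / (2 * self_pow \<gamma>)"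

definition growth :: "nat pmf \<Rightarrow> real \<Rightarrow> real" where
  "growth W a = (SUP \<gamma>\<in>{0..1/2}. fibre_growth W a \<gamma>)"

lemma rate_eq_growth:
  assumes "a > 0"
  shows "rate W a = - ln (growth W a)"
  using assms by (simp add: rate_def growth_def fibre_growth_def self_pow_def rpow_def mult.assoc)

text \<open>Boundedness makes the supremum \<open>growth\<close> a genuine least upper
  bound.\<close>

lemma fibre_growth_le_1:
  assumes "a > 0" "\<gamma> \<in> {0..1/2}"
  shows "fibre_growth W a \<gamma> \<le> 1"
proof -
  have "rho W (1 - 2 * \<gamma>) powr a \<le> 1"
    using assms abs_rho_le_1[of "1 - 2 * \<gamma>" W] rho_nonneg[of "1 - 2 * \<gamma>" W]
    by (intro powr_le1) auto
  then show ?thesis using assms self_pow_bounds[of \<gamma>] by (simp add: fibre_growth_def)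
qed

lemma fibre_growth_0: "fibre_growth W a 0 = 1/2"
  by (simp add: fibre_growth_def self_pow_def rpow_def rho_def)

lemma fibre_growth_le_growth:
  assumes "a > 0" "\<gamma> \<in> {0..1/2}"
  shows "fibre_growth W a \<gamma> \<le> growth W a"
  unfolding growth_def using assms fibre_growth_le_1
  by (intro cSUP_upper) (auto intro!: bdd_aboveI2[where M=1])

text \<open>The level \<gamma> = 0, that is, the trivial character, contributes 1/2. This keeps
  \<open>growth\<close> away from the singularity of the logarithm.\<close>

lemma growth_ge_half:
  assumes "a > 0"
  shows "1/2 \<le> growth W a"
  using fibre_growth_le_growth[OF assms, of 0 W] by (simp add: fibre_growth_0)

lemma continuous_on_fibre_growth:
  assumes "a > 0"
  shows "continuous_on {0..1/2} (fibre_growth W a)"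
proof -
  have "continuous_on {0..1/2} (\<lambda>\<gamma>. rho W (1 - 2 * \<gamma>) powr a)"
    using assms
    by (intro continuous_on_powr' continuous_on_compose2[OF continuous_on_rho] continuous_intros)
      (auto intro!: rho_nonneg)
  then show ?thesis
    unfolding fibre_growth_def
    by (intro continuous_on_divide continuous_on_mult_left continuous_on_subset[OF continuous_on_self_pow])
      (use self_pow_bounds(1) in force)+
qed

text \<open>Values below 1 could still have supremum 1, so compactness is used to attain the
  supremum at some \<gamma>. If \<gamma> = 0 the value is 1/2; otherwise \<open>rho\<close> is below
  1 there, while \<open>2 * self_pow \<gamma>\<close> is at least 1.\<close>

lemma growth_less_1:
  assumes "set_pmf W \<subseteq> {1..}" "a > 0"
  shows "growth W a < 1"
proof -
  obtain \<gamma> where \<gamma>: "\<gamma> \<in> {0..1/2}" "\<And>\<beta>. \<beta> \<in> {0..1/2} \<Longrightarrow> fibre_growth W a \<beta> \<le> fibre_growth W a \<gamma>"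
    using continuous_attains_sup[OF _ _ continuous_on_fibre_growth[OF assms(2), of W]] by fastforce
  have "growth W a \<le> fibre_growth W a \<gamma>"
    unfolding growth_def using \<gamma> by (intro cSUP_least) auto
  also have "\<dots> < 1"
  proof (cases "\<gamma> = 0")
    case False
    have "rho W (1 - 2 * \<gamma>) \<le> 1 - 2 * \<gamma>" using assms \<gamma> by (intro rho_le_self) auto
    then have "rho W (1 - 2 * \<gamma>) powr a < 1 powr a"
      using assms(2) \<gamma>(1) False by (intro powr_less_mono2 rho_nonneg) auto
    then show ?thesis using \<gamma>(1) self_pow_bounds[of \<gamma>] by (simp add: fibre_growth_def)
  qed (simp add: fibre_growth_0)
  finally show ?thesis .
qed

lemma growth_antimono:
  assumes "0 < a" "a \<le> b"
  shows "growth W b \<le> growth W a"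
  unfolding growth_def[of W b]
proof (intro cSUP_least)
  fix \<gamma> :: real assume \<gamma>: "\<gamma> \<in> {0..1/2}"
  have r: "0 \<le> rho W (1 - 2 * \<gamma>)" "rho W (1 - 2 * \<gamma>) \<le> 1"
    using \<gamma> rho_nonneg[of "1 - 2 * \<gamma>" W] abs_rho_le_1[of "1 - 2 * \<gamma>" W] by auto
  have "fibre_growth W b \<gamma> \<le> fibre_growth W a \<gamma>"
    unfolding fibre_growth_def using \<gamma> self_pow_bounds[of \<gamma>] r assms
    by (intro divide_right_mono powr_mono') auto
  also have "\<dots> \<le> growth W a" using assms \<gamma> by (intro fibre_growth_le_growth)
  finally show "fibre_growth W b \<gamma> \<le> growth W a" .
qed auto

lemma powr_convex_exponent:
  fixes r :: real
  assumes "0 \<le> r" "0 < x" "0 < y" "0 \<le> u" "0 \<le> v" "u + v = 1"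
  shows "r powr (u * x + v * y) \<le> u * r powr x + v * r powr y"
proof (cases "r = 0")
  case False
  have "convex_on UNIV (exp :: real \<Rightarrow> real)" by (rule exp_convex)
  then have "exp (u *\<^sub>R (x * ln r) + v *\<^sub>R (y * ln r)) \<le> u * exp (x * ln r) + v * exp (y * ln r)"
    using assms unfolding convex_on_def by blast
  then show ?thesis using False assms by (simp add: powr_def algebra_simps)
qed (use assms in simp)

text \<open>For each \<gamma> the quotient is convex in the exponent, and convexity survives the
  supremum. Continuity on the open half-line follows with no uniformity in \<gamma> to
  check.\<close>

lemma convex_on_growth: "convex_on {0<..} (growth W)"
proof (intro convex_onI)
  fix t x y :: real
  assume t: "0 < t" "t < 1" and x: "x \<in> {0<..}" and y: "y \<in> {0<..}"
  have p: "0 < (1 - t) * x + t * y" using t x y by (simp add: add_pos_pos)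
  show "growth W ((1 - t) *\<^sub>R x + t *\<^sub>R y) \<le> (1 - t) * growth W x + t * growth W y"
    unfolding growth_def[of W "(1 - t) *\<^sub>R x + t *\<^sub>R y"]
  proof (intro cSUP_least)
    fix \<gamma> :: real assume \<gamma>: "\<gamma> \<in> {0..1/2}"
    have "rho W (1 - 2 * \<gamma>) powr ((1 - t) * x + t * y)
        \<le> (1 - t) * rho W (1 - 2 * \<gamma>) powr x + t * rho W (1 - 2 * \<gamma>) powr y"
      using t x y \<gamma> by (intro powr_convex_exponent rho_nonneg) auto
    then have "fibre_growth W ((1 - t) * x + t * y) \<gamma>
        \<le> ((1 - t) * rho W (1 - 2 * \<gamma>) powr x + t * rho W (1 - 2 * \<gamma>) powr y) / (2 * self_pow \<gamma>)"
      unfolding fibre_growth_def using self_pow_bounds[of \<gamma>] \<gamma> by (intro divide_right_mono) auto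
    also have "\<dots> = (1 - t) * fibre_growth W x \<gamma> + t * fibre_growth W y \<gamma>"
      by (simp add: fibre_growth_def add_divide_distrib)
    also have "\<dots> \<le> (1 - t) * growth W x + t * growth W y"
      using t x y \<gamma> by (intro add_mono mult_left_mono fibre_growth_le_growth) auto
    finally show "fibre_growth W ((1 - t) *\<^sub>R x + t *\<^sub>R y) \<gamma> \<le> (1 - t) * growth W x + t * growth W y"
      by simp
  qed auto
qed simp

lemma continuous_on_growth: "continuous_on {0<..} (growth W)"
  by (intro convex_on_continuous convex_on_growth) auto

lemma rate_pos:
  assumes "set_pmf W \<subseteq> {1..}" "a > 0"
  shows "rate W a > 0"
  using growth_less_1[OF assms] growth_ge_half[OF assms(2), of W] assms(2)
  by (simp add: rate_eq_growth)

lemma continuous_on_rate: "continuous_on {0<..} (rate W)"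
proof -
  have "continuous_on {0<..} (\<lambda>a. - ln (growth W a))"
    using growth_ge_half[of _ W] by (intro continuous_intros continuous_on_growth) force
  then show ?thesis by (rule continuous_on_eq) (simp add: rate_eq_growth)
qed

lemma mono_on_rate: "mono_on {0<..} (rate W)"
proof (intro mono_onI)
  fix a b :: real assume "a \<in> {0<..}" "b \<in> {0<..}" "a \<le> b"
  then show "rate W a \<le> rate W b"
    using growth_antimono[of a b W] growth_ge_half[of b W] by (simp add: rate_eq_growth)
qed

section \<open>Binomial coefficients\<close>

text \<open>The \<open>n\<close>-th power clears the fractional exponents. Hence
  \<open>(n choose j) * self_pow (j / n) ^ n\<close> is the probability of the value
  \<open>j\<close> under the binomial distribution with parameters \<open>n\<close> and
  \<open>j / n\<close>.\<close>

lemma self_pow_power: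
  assumes "j \<le> n" "n \<ge> 1"
  shows "self_pow (j / n) ^ n = (j / n) ^ j * (1 - j / n) ^ (n - j)"
proof -
  have *: "rpow (i / n) (i / n) ^ n = (i / n) ^ i" for i :: nat
  proof (cases "i = 0")
    case False
    then have "((real i / n) powr (i / n)) ^ n = (real i / n) powr (real i / n * n)"
      using assms powr_realpow[of "(real i / n) powr (i / n)" n] by (simp add: powr_powr)
    also have "\<dots> = (real i / n) ^ i" using False assms by (simp add: powr_realpow)
    finally show ?thesis using False assms by (simp add: rpow_def)
  qed (simp add: rpow_def)
  have "1 - real j / n = real (n - j) / n"
    using assms by (simp add: of_nat_diff diff_divide_distrib)
  then show ?thesis by (simp add: self_pow_def power_mult_distrib *)
qed

text \<open>The Poisson weight j^i / i! is maximal at i = j: the quotient of the two factorials is a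
  product of |i - j| factors, all at most j if i \<le> j and all above j otherwise.
  Cross-multiplication keeps everything in the naturals.\<close>

lemma fact_mult_power_le: "fact j * j ^ i \<le> (fact i * j ^ j :: nat)"
proof (cases "i \<le> j")
  case True
  have "fact (i + d) \<le> (fact i * (i + d) ^ d :: nat)" for d
  proof (induction d)
    case (Suc d)
    have "(fact (i + Suc d) :: nat) = (i + Suc d) * fact (i + d)" by simp
    also have "\<dots> \<le> (i + Suc d) * (fact i * (i + d) ^ d)" using Suc by (rule mult_left_mono) simp
    also have "\<dots> \<le> (i + Suc d) * (fact i * (i + Suc d) ^ d)"
      by (intro mult_left_mono power_mono) auto
    finally show ?case by (simp add: mult_ac)
  qed simp
  from this[of "j - i"] have "fact j \<le> (fact i * j ^ (j - i) :: nat)" using True by simp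
  then have "fact j * j ^ i \<le> (fact i * j ^ (j - i)) * j ^ i" by (rule mult_right_mono) simp
  also have "\<dots> = fact i * j ^ j" using True by (simp add: mult.assoc power_add[symmetric])
  finally show ?thesis .
next
  case False
  have "fact j * j ^ d \<le> (fact (j + d) :: nat)" for d
  proof (induction d)
    case (Suc d)
    have "fact j * j ^ Suc d = j * (fact j * j ^ d)" by simp
    also have "\<dots> \<le> (j + Suc d) * fact (j + d)" using Suc by (intro mult_mono) auto
    finally show ?case by simp
  qed simp
  from this[of "i - j"] have "fact j * j ^ (i - j) \<le> (fact i :: nat)" using False by simp
  then have "(fact j * j ^ (i - j)) * j ^ j \<le> fact i * j ^ j" by (rule mult_right_mono) simp
  then show ?thesis using False by (simp add: mult.assoc power_add[symmetric])
qed

text \<open>The mode of the binomial distribution with parameters \<open>n\<close> and \<open>j / n\<close> is \<open>j\<close>.\<close>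

lemma binomial_mode:
  assumes "i \<le> n" "j \<le> n"
  shows "(n choose i) * (j ^ i * (n - j) ^ (n - i)) \<le> (n choose j) * (j ^ j * (n - j) ^ (n - j))"
proof -
  have ci: "(n choose i) * (fact i * fact (n - i)) = fact n" if "i \<le> n" for i
    using binomial_fact_lemma[OF that] by (simp add: mult_ac)
  have pos: "0 < fact i * fact (n - i) * (fact j * fact (n - j) :: nat)" by simp
  \<comment> \<open>One Poisson bound for the successes and one for the failures; the factor
    \<open>fact n\<close> then turns the factorials into binomial coefficients.\<close>
  have "(fact j * j ^ i) * (fact (n - j) * (n - j) ^ (n - i))
      \<le> (fact i * j ^ j) * (fact (n - i) * (n - j) ^ (n - j))"
    by (intro mult_mono fact_mult_power_le) auto
  then have "fact n * ((fact j * j ^ i) * (fact (n - j) * (n - j) ^ (n - i)))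
      \<le> fact n * ((fact i * j ^ j) * (fact (n - i) * (n - j) ^ (n - j)))"
    by (rule mult_left_mono) simp
  moreover have "fact n * ((fact j * j ^ i) * (fact (n - j) * (n - j) ^ (n - i)))
      = (fact i * fact (n - i) * (fact j * fact (n - j))) * ((n choose i) * (j ^ i * (n - j) ^ (n - i)))"
    unfolding ci[OF assms(1), symmetric] by (simp add: mult_ac)
  moreover have "fact n * ((fact i * j ^ j) * (fact (n - i) * (n - j) ^ (n - j)))
      = (fact i * fact (n - i) * (fact j * fact (n - j))) * ((n choose j) * (j ^ j * (n - j) ^ (n - j)))"
    unfolding ci[OF assms(2), symmetric] by (simp add: mult_ac)
  ultimately show ?thesis using pos by (metis mult_le_cancel1)
qed

text \<open>One binomial probability is at most the total mass 1.\<close>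

lemma binomial_self_pow_le_1:
  assumes "j \<le> n" "n \<ge> 1"
  shows "real (n choose j) * self_pow (j / n) ^ n \<le> 1"
proof -
  define x where "x = real j / n"
  have x: "0 \<le> x" "x \<le> 1" using assms by (auto simp: x_def)
  have "real (n choose j) * x ^ j * (1 - x) ^ (n - j)
      \<le> (\<Sum>i\<le>n. real (n choose i) * x ^ i * (1 - x) ^ (n - i))"
    using x assms by (intro member_le_sum) auto
  also have "\<dots> = (x + (1 - x)) ^ n" by (rule binomial_ring[symmetric])
  finally show ?thesis using self_pow_power[OF assms] by (simp add: x_def mult.assoc)
qed

text \<open>The mass 1 is spread over n + 1 values, so the mode carries at least 1/(n + 1) of
  it.\<close>

lemma binomial_self_pow_ge:
  assumes "j \<le> n" "n \<ge> 1"
  shows "1 \<le> real (n + 1) * (real (n choose j) * self_pow (j / n) ^ n)"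
proof -
  define x where "x = real j / n"
  have y: "1 - x = real (n - j) / n"
    using assms by (simp add: x_def of_nat_diff diff_divide_distrib)
  have mode: "real (n choose i) * x ^ i * (1 - x) ^ (n - i) \<le> real (n choose j) * x ^ j * (1 - x) ^ (n - j)"
    if "i \<le> n" for i
  proof -
    have *: "real (n choose k) * x ^ k * (1 - x) ^ (n - k)
        = real ((n choose k) * (j ^ k * (n - j) ^ (n - k))) / real n ^ n" if "k \<le> n" for k
    proof -
      have "real n ^ n = real n ^ k * real n ^ (n - k)" using that by (simp add: power_add[symmetric])
      moreover have "x ^ k = real j ^ k / real n ^ k" by (simp only: x_def power_divide)
      moreover have "(1 - x) ^ (n - k) = real (n - j) ^ (n - k) / real n ^ (n - k)"
        by (simp only: y power_divide)
      ultimately show ?thesis by simp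
    qed
    show ?thesis unfolding *[OF that] *[OF assms(1)]
      using binomial_mode[OF that assms(1)] by (intro divide_right_mono of_nat_mono) auto
  qed
  have "1 = (x + (1 - x)) ^ n" by simp
  also have "\<dots> = (\<Sum>i\<le>n. real (n choose i) * x ^ i * (1 - x) ^ (n - i))" by (rule binomial_ring)
  also have "\<dots> \<le> (\<Sum>i\<le>n. real (n choose j) * x ^ j * (1 - x) ^ (n - j))"
    using mode by (intro sum_mono) auto
  also have "\<dots> = real (n + 1) * (real (n choose j) * self_pow x ^ n)"
    using self_pow_power[OF assms] by (simp add: x_def)
  finally show ?thesis by (simp add: x_def)
qed

section \<open>Means of products over subsets\<close>

definition esym :: "'a set \<Rightarrow> ('a \<Rightarrow> real) \<Rightarrow> nat \<Rightarrow> real" where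
  "esym A s k = (\<Sum>T | T \<subseteq> A \<and> card T = k. \<Prod>t\<in>T. s t)"

text \<open>For finite \<open>A\<close>, \<open>esym\<close> is the elementary symmetric polynomial
  of degree \<open>k\<close>, and the quotient is the mean product of \<open>k\<close> values drawn
  without replacement. For \<open>k > card A\<close> it is 0, by division by zero.\<close>

definition esym_mean :: "'a set \<Rightarrow> ('a \<Rightarrow> real) \<Rightarrow> nat \<Rightarrow> real" where
  "esym_mean A s k = esym A s k / real (card A choose k)"

lemma finite_subsets_card: "finite A \<Longrightarrow> finite {T. T \<subseteq> A \<and> card T = k}"
  by (rule finite_subset[of _ "Pow A"]) auto

text \<open>Double counting of the sets \<open>U\<close> of size \<open>k + 1\<close> with a marked
  element \<open>t\<close>: each pair \<open>(U, t)\<close> corresponds to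
  \<open>T = U - {t}\<close> and a point \<open>t\<close> outside \<open>T\<close>.\<close>

lemma esym_Suc:
  assumes "finite A"
  shows "real (Suc k) * esym A s (Suc k) =
    (\<Sum>T | T \<subseteq> A \<and> card T = k. \<Sum>t\<in>A - T. s t * (\<Prod>u\<in>T. s u))"
proof -
  have fin: "finite T" if "T \<subseteq> A" for T using that assms by (rule finite_subset)
  have "real (Suc k) * esym A s (Suc k) = (\<Sum>U | U \<subseteq> A \<and> card U = Suc k. \<Sum>t\<in>U. \<Prod>u\<in>U. s u)"
    by (simp add: esym_def sum_distrib_left)
  also have "\<dots> = (\<Sum>(U, t)\<in>(SIGMA U:{U. U \<subseteq> A \<and> card U = Suc k}. U). \<Prod>u\<in>U. s u)"
    using assms fin by (intro sum.Sigma finite_subsets_card) auto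
  also have "\<dots> = (\<Sum>(T, t)\<in>(SIGMA T:{T. T \<subseteq> A \<and> card T = k}. A - T). s t * (\<Prod>u\<in>T. s u))"
    by (rule sum.reindex_bij_witness
        [where i="\<lambda>(T, t). (insert t T, t)" and j="\<lambda>(U, t). (U - {t}, t)"])
      (auto simp: fin insert_absorb prod.remove)
  also have "\<dots> = (\<Sum>T | T \<subseteq> A \<and> card T = k. \<Sum>t\<in>A - T. s t * (\<Prod>u\<in>T. s u))"
    using assms by (intro sum.Sigma[symmetric] finite_subsets_card) auto
  finally show ?thesis .
qed

context
  fixes A :: "'a set" and s :: "'a \<Rightarrow> real"
  assumes fin: "finite A" and s: "\<And>t. t \<in> A \<Longrightarrow> \<bar>s t\<bar> \<le> 1"
begin

lemma abs_prod_subset_le_1: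
  assumes "T \<subseteq> A"
  shows "\<bar>\<Prod>t\<in>T. s t\<bar> \<le> 1"
  unfolding abs_prod using assms s by (intro prod_le_1) auto

lemma abs_esym_le: "\<bar>esym A s k\<bar> \<le> real (card A choose k)"
proof -
  have "\<bar>esym A s k\<bar> \<le> (\<Sum>T | T \<subseteq> A \<and> card T = k. \<bar>\<Prod>t\<in>T. s t\<bar>)"
    unfolding esym_def by (rule sum_abs)
  also have "\<dots> \<le> (\<Sum>T | T \<subseteq> A \<and> card T = k. 1)"
    by (intro sum_mono abs_prod_subset_le_1) auto
  also have "\<dots> = real (card A choose k)" using n_subsets[OF fin] by simp
  finally show ?thesis .
qed

lemma abs_esym_mean_le_1: "\<bar>esym_mean A s k\<bar> \<le> 1"
  using abs_esym_le[of k] by (auto simp: esym_mean_def divide_le_eq_1)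

text \<open>Letting \<open>t\<close> in \<open>esym_Suc\<close> range over all of \<open>A\<close>,
  as in sampling with replacement, adds only the terms with \<open>t \<in> T\<close>. There are
  \<open>k\<close> of them for each \<open>T\<close>, each at most 1 in absolute value.\<close>

lemma abs_esym_Suc_diff_le:
  "\<bar>real (Suc k) * esym A s (Suc k) - sum s A * esym A s k\<bar> \<le> real k * real (card A choose k)"
proof -
  have "real (Suc k) * esym A s (Suc k) - sum s A * esym A s k =
      (\<Sum>T | T \<subseteq> A \<and> card T = k. (\<Sum>t\<in>A - T. s t * (\<Prod>u\<in>T. s u)) - sum s A * (\<Prod>u\<in>T. s u))"
    unfolding esym_Suc[OF fin] by (simp add: esym_def sum_subtractf sum_distrib_left)
  also have "\<dots> = (\<Sum>T | T \<subseteq> A \<and> card T = k. - (sum s T * (\<Prod>u\<in>T. s u)))"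
    by (intro sum.cong refl)
      (auto simp: sum_diff[OF fin] sum_distrib_right[symmetric] left_diff_distrib)
  also have "\<bar>\<dots>\<bar> \<le> (\<Sum>T | T \<subseteq> A \<and> card T = k. real k)"
  proof (rule sum_abs[THEN order_trans], rule sum_mono)
    fix T assume T: "T \<in> {T. T \<subseteq> A \<and> card T = k}"
    have "\<bar>sum s T\<bar> \<le> (\<Sum>t\<in>T. \<bar>s t\<bar>)" by (rule sum_abs)
    also have "\<dots> \<le> (\<Sum>t\<in>T. 1)" using T s by (intro sum_mono) auto
    finally have "\<bar>sum s T\<bar> \<le> real k" using T by simp
    then have "\<bar>sum s T\<bar> * \<bar>\<Prod>u\<in>T. s u\<bar> \<le> real k * 1"
      using T abs_prod_subset_le_1[of T] by (intro mult_mono) auto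
    then show "\<bar>- (sum s T * (\<Prod>u\<in>T. s u))\<bar> \<le> real k" by (simp add: abs_mult)
  qed
  also have "\<dots> = real k * real (card A choose k)" using n_subsets[OF fin] by simp
  finally show ?thesis .
qed

text \<open>Dividing the previous bound by the binomial coefficient leaves the factor
  \<open>n - k\<close> on the leading term and an error \<open>k\<close>. Replacing
  \<open>n - k\<close> by \<open>n\<close> costs another \<open>k\<close>, hence the constant
  2.\<close>

lemma abs_esym_mean_Suc_diff_le:
  assumes "k < card A"
  shows "\<bar>esym_mean A s (Suc k) - sum s A / card A * esym_mean A s k\<bar> \<le> 2 * real k / card A"
proof -
  define n where "n = card A"
  define c where "c = real (n choose k)"
  have n: "k < n" using assms by (simp add: n_def)
  have c: "c > 0" using n by (simp add: c_def)
  have abs: "real (Suc k) * real (n choose Suc k) = real (n - k) * c"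
    unfolding c_def of_nat_mult[symmetric] using binomial_absorb_comp[of n k] Suc_times_binomial_eq
    by (metis binomial_absorption mult.commute binomial_absorb_comp)
  have "real (n choose Suc k) > 0" using n by simp
  then have "real (Suc k) * esym A s (Suc k) = real (n - k) * c * esym_mean A s (Suc k)"
    unfolding esym_mean_def n_def[symmetric] abs[symmetric] by simp
  moreover have "esym A s k = c * esym_mean A s k"
    using c by (simp add: esym_mean_def c_def n_def)
  ultimately have "\<bar>c * (real (n - k) * esym_mean A s (Suc k) - sum s A * esym_mean A s k)\<bar> \<le> real k * c"
    using abs_esym_Suc_diff_le[of k] by (simp add: n_def[symmetric] c_def[symmetric] algebra_simps)
  then have "\<bar>real (n - k) * esym_mean A s (Suc k) - sum s A * esym_mean A s k\<bar> \<le> real k"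
    using c by (simp add: abs_mult mult.commute)
  moreover have "\<bar>real k * esym_mean A s (Suc k)\<bar> \<le> real k"
    using abs_esym_mean_le_1[of "Suc k"] by (simp add: abs_mult mult_left_le)
  ultimately have "\<bar>real n * esym_mean A s (Suc k) - sum s A * esym_mean A s k\<bar> \<le> 2 * real k"
    using n by (simp add: of_nat_diff left_diff_distrib)
  then have "\<bar>real n * esym_mean A s (Suc k) - sum s A * esym_mean A s k\<bar> / real n \<le> 2 * real k / real n"
    by (intro divide_right_mono) auto
  also have "\<bar>real n * esym_mean A s (Suc k) - sum s A * esym_mean A s k\<bar> / real n
      = \<bar>(real n * esym_mean A s (Suc k) - sum s A * esym_mean A s k) / real n\<bar>"
    by (simp add: abs_divide)
  also have "(real n * esym_mean A s (Suc k) - sum s A * esym_mean A s k) / real n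
      = esym_mean A s (Suc k) - sum s A / real n * esym_mean A s k"
    using n by (simp add: diff_divide_distrib)
  finally show ?thesis by (simp add: n_def)
qed

text \<open>Sampling without replacement is close to sampling with replacement.\<close>

lemma abs_esym_mean_power_diff_le:
  assumes "k \<le> card A"
  shows "\<bar>esym_mean A s k - (sum s A / card A) ^ k\<bar> \<le> (real k)\<^sup>2 / card A"
  using assms
proof (induction k)
  case 0
  have "{T. T \<subseteq> A \<and> card T = 0} = {{}}" using fin by (auto dest: finite_subset)
  then show ?case by (simp add: esym_mean_def esym_def)
next
  case (Suc k)
  define \<sigma> where "\<sigma> = sum s A / card A"
  have "\<bar>sum s A\<bar> \<le> (\<Sum>t\<in>A. 1)" using s by (intro sum_abs[THEN order_trans] sum_mono)
  then have \<sigma>: "\<bar>\<sigma>\<bar> \<le> 1" using Suc.prems by (simp add: \<sigma>_def)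
  \<comment> \<open>The error grows by at most 2k/n in each step, and k^2 + 2k \<le> (k + 1)^2
    closes the induction.\<close>
  have "\<bar>esym_mean A s (Suc k) - \<sigma> ^ Suc k\<bar>
      \<le> \<bar>esym_mean A s (Suc k) - \<sigma> * esym_mean A s k\<bar> + \<bar>\<sigma>\<bar> * \<bar>esym_mean A s k - \<sigma> ^ k\<bar>"
    unfolding abs_mult[symmetric] by (rule order_trans[OF _ abs_triangle_ineq]) (simp add: algebra_simps)
  also have "\<dots> \<le> 2 * real k / card A + 1 * ((real k)\<^sup>2 / card A)"
    using Suc \<sigma> abs_esym_mean_Suc_diff_le[of k]
    by (intro add_mono mult_mono) (auto simp: \<sigma>_def)
  also have "\<dots> = (2 * real k + (real k)\<^sup>2) / card A" by (simp add: add_divide_distrib)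
  also have "\<dots> \<le> (real (Suc k))\<^sup>2 / card A"
    by (intro divide_right_mono) (auto simp: power2_eq_square algebra_simps)
  finally show ?case by (simp add: \<sigma>_def)
qed

end

section \<open>Fourier inversion\<close>

definition character :: "nat set \<Rightarrow> (nat \<Rightarrow> nat) \<Rightarrow> real" where
  "character S x = (\<Prod>j\<in>S. (-1) ^ x j)"

definition sign_on :: "'a set \<Rightarrow> 'a \<Rightarrow> real" where
  "sign_on S t = (if t \<in> S then -1 else 1)"

text \<open>Closed form of the expected character of \<open>S\<close>: given weight
  \<open>k\<close>, the support is a uniform \<open>k\<close>-subset and the character is the
  product of the signs on it. The agreement is \<open>expectation_character\<close>.\<close>

definition fourier :: "nat \<Rightarrow> nat pmf \<Rightarrow> nat set \<Rightarrow> real" where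
  "fourier n w S = (\<Sum>k\<le>n. pmf w k * esym_mean {1..n} (sign_on S) k)"

lemma finite_binary_vectors: "finite (binary_vectors n)"
  unfolding binary_vectors_def by (intro finite_PiE) auto

lemma sum_binary_vectors:
  "(\<Sum>x\<in>binary_vectors n. h {j\<in>{1..n}. x j = 1}) = (\<Sum>T\<in>Pow {1..n}. h T)"
  by (rule sum.reindex_bij_witness
      [where i="\<lambda>T. \<lambda>j\<in>{1..n}. if j \<in> T then 1 else 0" and j="\<lambda>x. {j\<in>{1..n}. x j = 1}"])
    (auto simp: binary_vectors_def PiE_iff extensional_def restrict_def fun_eq_iff)

lemma card_weight_eq: "card {y \<in> binary_vectors n. weight n y = k} = n choose k"
proof -
  have "card {y \<in> binary_vectors n. weight n y = k}
      = (\<Sum>y\<in>binary_vectors n. if card {j\<in>{1..n}. y j = 1} = k then 1 else 0)"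
    using finite_binary_vectors[of n] by (simp add: weight_def sum.If_cases Int_def)
  also have "\<dots> = (\<Sum>T\<in>Pow {1..n}. if card T = k then 1 else 0)"
    by (rule sum_binary_vectors[where h="\<lambda>T. if card T = k then 1 else 0"])
  also have "\<dots> = card {T. T \<subseteq> {1..n} \<and> card T = k}"
    by (simp add: sum.If_cases Int_def)
  also have "\<dots> = n choose k" using n_subsets[of "{1..n}" k] by simp
  finally show ?thesis .
qed

text \<open>Both sides are (-1)^r, where r is the number of points of \<open>S\<close> in the
  support of \<open>x\<close>. The exchange makes the support, over which the mean is taken, the
  index set of the product.\<close>

lemma character_eq_prod_sign_on:
  assumes x: "x \<in> binary_vectors n" and S: "S \<subseteq> {1..n}"
  shows "character S x = (\<Prod>t | t \<in> {1..n} \<and> x t = 1. sign_on S t)"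
proof -
  have fin: "finite S" using S by (rule finite_subset) auto
  have "(-1 :: real) ^ x j = (if x j = 1 then -1 else 1)" if "j \<in> S" for j
  proof -
    have "x j \<in> {0, 1}" using x S that unfolding binary_vectors_def by blast
    then show ?thesis by auto
  qed
  then have "character S x = (\<Prod>j\<in>S. if x j = 1 then -1 else 1)"
    unfolding character_def by (intro prod.cong) auto
  also have "\<dots> = (\<Prod>j\<in>S \<inter> {j. x j = 1}. -1)"
    using fin by (simp add: prod.If_cases)
  also have "S \<inter> {j. x j = 1} = {t\<in>{1..n}. x t = 1} \<inter> S"
    using S by blast
  also have "(\<Prod>t\<in>{t\<in>{1..n}. x t = 1} \<inter> S. -1) = (\<Prod>t | t \<in> {1..n} \<and> x t = 1. sign_on S t)"
    by (simp add: sign_on_def prod.If_cases)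
  finally show ?thesis .
qed

context
  fixes n :: nat and w :: "nat pmf" and M :: "'a measure" and X :: "nat \<Rightarrow> 'a \<Rightarrow> nat \<Rightarrow> nat"
  assumes iid: "iid_weighted_vectors n w M X"
begin

interpretation prob_space M
  using iid by (simp add: iid_weighted_vectors_def)

lemma measurable_vector:
  assumes "i \<ge> 1"
  shows "X i \<in> measurable M (count_space (binary_vectors n))"
  using iid assms by (auto simp: iid_weighted_vectors_def indep_vars_def)

lemma prob_vector_eq:
  assumes "i \<ge> 1" "x \<in> binary_vectors n"
  shows "measure M {\<omega> \<in> space M. X i \<omega> = x} = pmf w (weight n x) / real (n choose weight n x)"
proof -
  define k where "k = weight n x"
  let ?Q = "{\<omega> \<in> space M. weight n (X i \<omega>) = k}"
  have m: "(\<lambda>\<omega>. weight n (X i \<omega>)) \<in> measurable M (count_space UNIV)"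
    by (rule measurable_compose[OF measurable_vector[OF assms(1)]]) simp
  have "measure M ?Q = measure (distr M (count_space UNIV) (\<lambda>\<omega>. weight n (X i \<omega>))) {k}"
    using m by (subst measure_distr) (auto intro!: arg_cong[where f="measure M"])
  also have "\<dots> = pmf w k"
    using iid assms(1) by (simp add: iid_weighted_vectors_def measure_pmf_single)
  finally have Q: "measure M ?Q = pmf w k" .
  \<comment> \<open>The value \<open>x\<close> forces the weight \<open>k\<close>, so the joint
    event in \<open>cond_prob\<close> is simply the event that the vector equals
    \<open>x\<close>.\<close>
  have sub: "{\<omega> \<in> space M. X i \<omega> = x} = {\<omega> \<in> space M. X i \<omega> = x \<and> weight n (X i \<omega>) = k}"
    by (auto simp: k_def)
  have ev: "?Q \<in> sets M" using m by measurable
  show ?thesis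
  proof (cases "k \<in> set_pmf w")
    case True
    then have "cond_prob M (\<lambda>\<omega>. X i \<omega> = x) (\<lambda>\<omega>. weight n (X i \<omega>) = k) = 1 / real (n choose k)"
      using iid assms by (simp add: iid_weighted_vectors_def k_def card_weight_eq)
    then show ?thesis
      using True pmf_positive[OF True] unfolding cond_prob_def Q sub[symmetric] k_def[symmetric]
      by (simp add: field_simps)
  next
    \<comment> \<open>The conditional law is not prescribed for a weight of probability 0; both
      sides vanish because the event lies in a null event.\<close>
    case False
    then have "measure M ?Q = 0" using Q by (simp add: set_pmf_iff)
    moreover have "measure M {\<omega> \<in> space M. X i \<omega> = x} \<le> measure M ?Q"
      unfolding sub using ev by (intro finite_measure_mono) auto
    ultimately show ?thesis using False
      by (simp add: k_def[symmetric] set_pmf_iff measure_le_0_iff)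
  qed
qed

lemma expectation_character:
  assumes "i \<ge> 1" "S \<subseteq> {1..n}"
  shows "expectation (\<lambda>\<omega>. character S (X i \<omega>)) = fourier n w S"
proof -
  \<comment> \<open>The summand depends on the vector only through its support, which permits the
    passage from vectors to subsets and then the grouping by size.\<close>
  define h where "h T = pmf w (card T) / real (n choose card T) * (\<Prod>t\<in>T. sign_on S t)" for T
  have ev: "{\<omega> \<in> space M. X i \<omega> = x} \<in> sets M" if "x \<in> binary_vectors n" for x
    using measurable_sets[OF measurable_vector[OF assms(1)], of "{x}"] that
    by (simp add: vimage_def Int_def conj_commute)
  have "expectation (\<lambda>\<omega>. character S (X i \<omega>))
      = expectation (\<lambda>\<omega>. \<Sum>x\<in>binary_vectors n. indicator {\<omega> \<in> space M. X i \<omega> = x} \<omega> * character S x)"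
  proof (rule Bochner_Integration.integral_cong[OF refl])
    fix \<omega> assume \<omega>: "\<omega> \<in> space M"
    then have "X i \<omega> \<in> binary_vectors n"
      using measurable_space[OF measurable_vector[OF assms(1)]] by simp
    moreover have "indicator {\<omega> \<in> space M. X i \<omega> = x} \<omega> * character S x
        = (if X i \<omega> = x then character S x else 0)" for x
      using \<omega> by (simp add: indicator_def)
    ultimately show "character S (X i \<omega>)
        = (\<Sum>x\<in>binary_vectors n. indicator {\<omega> \<in> space M. X i \<omega> = x} \<omega> * character S x)"
      by (simp add: finite_binary_vectors sum.delta)
  qed
  also have "\<dots> = (\<Sum>x\<in>binary_vectors n. expectation (\<lambda>\<omega>. indicator {\<omega> \<in> space M. X i \<omega> = x} \<omega> * character S x))"
    using ev by (intro Bochner_Integration.integral_sum integrable_mult_left)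
      (auto intro!: integrable_real_indicator simp: emeasure_eq_measure)
  also have "\<dots> = (\<Sum>x\<in>binary_vectors n. measure M {\<omega> \<in> space M. X i \<omega> = x} * character S x)"
    using ev by (intro sum.cong) (auto simp: Int_absorb2 subset_eq)
  also have "\<dots> = (\<Sum>x\<in>binary_vectors n. h {j\<in>{1..n}. x j = 1})"
    using prob_vector_eq[OF assms(1)] assms(2)
    by (intro sum.cong) (auto simp: weight_def character_eq_prod_sign_on h_def)
  also have "\<dots> = (\<Sum>T\<in>Pow {1..n}. h T)"
    by (rule sum_binary_vectors)
  also have "\<dots> = (\<Sum>k\<le>n. \<Sum>T\<in>{T\<in>Pow {1..n}. card T = k}. h T)"
    using card_mono[of "{1..n}"] by (intro sum.group[symmetric]) auto
  also have "\<dots> = fourier n w S"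
    by (auto simp: h_def fourier_def esym_mean_def esym_def sum_distrib_left sum_divide_distrib intro!: sum.cong)
  finally show ?thesis .
qed

lemma prob_zero_sum_event:
  "measure M (zero_sum_event n m M X) = (\<Sum>S\<in>Pow {1..n}. fourier n w S ^ m) / 2 ^ n"
proof -
  have borel: "(\<lambda>\<omega>. character S (X i \<omega>)) \<in> borel_measurable M" if "i \<ge> 1" for i S
    by (rule measurable_compose[OF measurable_vector[OF that]]) simp
  have abs1: "\<bar>character S x\<bar> \<le> 1" for S x
    by (simp add: character_def abs_prod)
  have int: "integrable M (\<lambda>\<omega>. character S (X i \<omega>))" if "i \<ge> 1" for i S
    using abs1 borel[OF that] by (intro integrable_const_bound[where B=1]) auto
  have ind: "indep_vars (\<lambda>_. borel) (\<lambda>i \<omega>. character S (X i \<omega>)) {1..m}" for S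
  proof (rule indep_vars_compose2[where X=X and Y="\<lambda>_. character S"])
    show "indep_vars (\<lambda>_. count_space (binary_vectors n)) X {1..m}"
      by (rule indep_vars_subset[of _ _ "{1..}"]) (use iid in \<open>auto simp: iid_weighted_vectors_def\<close>)
  qed simp
  have intprod: "integrable M (\<lambda>\<omega>. \<Prod>i\<in>{1..m}. character S (X i \<omega>))" for S
    using ind int by (intro indep_vars_integrable) auto
  have pt: "indicator (zero_sum_event n m M X) \<omega>
      = (\<Sum>S\<in>Pow {1..n}. (\<Prod>i\<in>{1..m}. character S (X i \<omega>))) / 2 ^ n" if "\<omega> \<in> space M" for \<omega>
  proof -
    let ?y = "\<lambda>j. \<Sum>i=1..m. X i \<omega> j"
    \<comment> \<open>Each factor is 1 if the coordinate sum is even and 0 otherwise. Expanding the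
      product over the coordinates yields one character for each \<open>S\<close>.\<close>
    have "indicator (zero_sum_event n m M X) \<omega> = (\<Prod>j\<in>{1..n}. (1 + (-1) ^ ?y j) / 2 :: real)"
    proof (cases "\<forall>j\<in>{1..n}. even (?y j)")
      case True
      then show ?thesis using that by (simp add: zero_sum_event_def cong_0_iff)
    next
      case False
      then obtain j where j: "j \<in> {1..n}" "odd (?y j)" by blast
      then have "(\<Prod>j\<in>{1..n}. (1 + (-1) ^ ?y j) / 2 :: real) = 0"
        by (intro prod_zero bexI[of _ j]) auto
      then show ?thesis using that False by (auto simp: zero_sum_event_def cong_0_iff indicator_def)
    qed
    also have "\<dots> = (\<Prod>j\<in>{1..n}. (-1) ^ ?y j + 1) / 2 ^ n"
      by (simp add: prod_dividef add.commute)
    also have "(\<Prod>j\<in>{1..n}. (-1) ^ ?y j + 1 :: real) = (\<Sum>S\<in>Pow {1..n}. \<Prod>j\<in>S. (-1) ^ ?y j)"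
      by (subst prod_add) auto
    \<comment> \<open>Characters are multiplicative: the sign of a sum is the product of the signs,
      and the two products are interchanged.\<close>
    also have "\<dots> = (\<Sum>S\<in>Pow {1..n}. \<Prod>i\<in>{1..m}. character S (X i \<omega>))"
      unfolding character_def power_sum by (intro sum.cong refl prod.swap)
    finally show ?thesis .
  qed
  have meas: "zero_sum_event n m M X \<in> sets M"
  proof -
    have "(\<lambda>\<omega>. X i \<omega> j) \<in> measurable M (count_space UNIV)" if "i \<ge> 1" for i j
      by (rule measurable_compose[OF measurable_vector[OF that]]) simp
    then have "(\<lambda>\<omega>. \<Sum>i=1..m. X i \<omega> j) \<in> measurable M (count_space UNIV)" for j
      by (intro measurable_sum_nat) auto
    then show ?thesis unfolding zero_sum_event_def by measurable
  qed
  have "measure M (zero_sum_event n m M X) = expectation (indicator (zero_sum_event n m M X))"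
    using meas by simp
  also have "\<dots> = expectation (\<lambda>\<omega>. (\<Sum>S\<in>Pow {1..n}. (\<Prod>i\<in>{1..m}. character S (X i \<omega>))) / 2 ^ n)"
    using pt by (intro Bochner_Integration.integral_cong) auto
  also have "\<dots> = (\<Sum>S\<in>Pow {1..n}. expectation (\<lambda>\<omega>. \<Prod>i\<in>{1..m}. character S (X i \<omega>))) / 2 ^ n"
    using intprod by (simp add: Bochner_Integration.integral_sum)
  also have "\<dots> = (\<Sum>S\<in>Pow {1..n}. fourier n w S ^ m) / 2 ^ n"
  proof (intro arg_cong[where f="\<lambda>x. x / 2 ^ n"] sum.cong refl)
    fix S assume "S \<in> Pow {1..n}"
    then have "(\<Prod>i\<in>{1..m}. expectation (\<lambda>\<omega>. character S (X i \<omega>))) = fourier n w S ^ m"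
      using expectation_character[of _ S] by simp
    then show "expectation (\<lambda>\<omega>. \<Prod>i\<in>{1..m}. character S (X i \<omega>)) = fourier n w S ^ m"
      using indep_vars_lebesgue_integral[OF _ ind int] by simp
  qed
  finally show ?thesis .
qed

end

section \<open>Uniform convergence of the Fourier coefficients\<close>

lemma cdf_distr_pmf_nat:
  "cdf (distr (measure_pmf p) borel real) x = measure_pmf.prob p {..j}"
  if "real j \<le> x" "x < real (Suc j)"
proof -
  have "{k. real k \<le> x} = {..j}" using that by auto
  then show ?thesis by (simp add: cdf_def measure_distr vimage_def)
qed

text \<open>The limiting distribution function is constant between consecutive integers, so each j +
  1/2 is a continuity point. Point masses are differences of the values there.\<close>

lemma weak_conv_pmf:
  fixes W :: "nat pmf" and Wn :: "nat \<Rightarrow> nat pmf"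
  assumes "weak_conv_m (\<lambda>n. distr (measure_pmf (Wn n)) borel real) (distr (measure_pmf W) borel real)"
  shows "(\<lambda>n. pmf (Wn n) k) \<longlonglongrightarrow> pmf W k"
proof -
  have lim: "(\<lambda>n. measure_pmf.prob (Wn n) {..j}) \<longlonglongrightarrow> measure_pmf.prob W {..j}" for j
  proof -
    have "isCont (cdf (distr (measure_pmf W) borel real)) (j + 1/2)"
    proof (rule continuous_on_interior)
      show "continuous_on {real j..<real (Suc j)} (cdf (distr (measure_pmf W) borel real))"
        by (rule continuous_on_eq[OF continuous_on_const[of _ "measure_pmf.prob W {..j}"]])
          (auto intro: cdf_distr_pmf_nat[of j, symmetric])
    qed (auto intro!: interiorI[of "{real j<..<real (Suc j)}"])
    then have "(\<lambda>n. cdf (distr (measure_pmf (Wn n)) borel real) (j + 1/2))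
        \<longlonglongrightarrow> cdf (distr (measure_pmf W) borel real) (j + 1/2)"
      using assms by (simp add: weak_conv_m_def weak_conv_def)
    then show ?thesis by (simp add: cdf_distr_pmf_nat[of j])
  qed
  have pmf_0: "pmf p 0 = measure_pmf.prob p {..0}" for p :: "nat pmf"
    by (simp add: measure_pmf_single atMost_0)
  have pmf_Suc: "pmf p (Suc j) = measure_pmf.prob p {..Suc j} - measure_pmf.prob p {..j}" for p :: "nat pmf" and j
    by (simp add: measure_measure_pmf_finite)
  show ?thesis
    by (cases k) (simp only: pmf_0 pmf_Suc, intro tendsto_diff lim)+
qed

lemma sum_pmf_le_1: "(\<Sum>k\<in>A. pmf p k) \<le> 1" if "finite A"
  using that by (simp add: measure_measure_pmf_finite[symmetric])

lemma sum_sign_on: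
  assumes "S \<subseteq> {1..n}"
  shows "sum (sign_on S) {1..n} = real n - 2 * real (card S)"
proof -
  have fin: "finite S" using assms by (rule finite_subset) auto
  have "sum (sign_on S) {1..n} = (\<Sum>t\<in>{1..n}. 1 - (if t \<in> S then 2 else 0))"
    by (intro sum.cong) (auto simp: sign_on_def)
  also have "\<dots> = real n - (\<Sum>t\<in>{1..n} \<inter> S. 2)"
    by (subst sum_subtractf) (simp add: sum.If_cases)
  also have "{1..n} \<inter> S = S" using assms by blast
  finally show ?thesis by simp
qed

lemma abs_sign_on_le_1: "\<bar>sign_on S t\<bar> \<le> 1"
  by (simp add: sign_on_def)

lemma abs_fourier_le_1: "\<bar>fourier n w S\<bar> \<le> 1"
proof -
  have "\<bar>fourier n w S\<bar> \<le> (\<Sum>k\<le>n. pmf w k * \<bar>esym_mean {1..n} (sign_on S) k\<bar>)"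
    unfolding fourier_def by (rule order_trans[OF sum_abs]) (simp add: abs_mult)
  also have "\<dots> \<le> (\<Sum>k\<le>n. pmf w k * 1)"
    by (intro sum_mono mult_left_mono abs_esym_mean_le_1 abs_sign_on_le_1) auto
  also have "\<dots> \<le> 1" using sum_pmf_le_1[of "{..n}" w] by simp
  finally show ?thesis .
qed

text \<open>The discarded powers are at most 1 in absolute value, so the error is at most the tail
  mass.\<close>

lemma abs_rho_truncation_le:
  assumes "\<bar>s\<bar> \<le> 1"
  shows "\<bar>rho W s - (\<Sum>k\<le>N. pmf W k * s ^ k)\<bar> \<le> 1 - (\<Sum>k\<le>N. pmf W k)"
proof -
  have int: "integrable (measure_pmf W) (\<lambda>k. indicator A k * s ^ k)" for A
    using assms by (intro measure_pmf.integrable_const_bound[where B=1])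
      (auto simp: indicator_def power_abs intro!: power_le_one)
  have "(\<Sum>k\<le>N. pmf W k * s ^ k) = measure_pmf.expectation W (\<lambda>k. indicator {..N} k * s ^ k)"
    by (subst integral_measure_pmf_real[of "{..N}"]) (auto simp: indicator_def mult.commute)
  then have "rho W s - (\<Sum>k\<le>N. pmf W k * s ^ k)
      = measure_pmf.expectation W (\<lambda>k. s ^ k - indicator {..N} k * s ^ k)"
    unfolding rho_def using integrable_power_pmf[OF assms] int
    by (simp add: Bochner_Integration.integral_diff)
  also have "\<dots> = measure_pmf.expectation W (\<lambda>k. indicator {N<..} k * s ^ k)"
    by (intro Bochner_Integration.integral_cong) (auto simp: indicator_def)
  also have "\<bar>\<dots>\<bar> \<le> measure_pmf.expectation W (\<lambda>k. \<bar>indicator {N<..} k * s ^ k\<bar>)"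
    by (rule integral_abs_bound)
  also have "\<dots> \<le> measure_pmf.expectation W (indicator {N<..})"
    using int assms
    by (intro integral_mono integrable_abs int)
      (auto simp: indicator_def power_abs power_le_one intro!: measure_pmf.integrable_const_bound[where B=1])
  also have "\<dots> = measure_pmf.prob W (- {..N})" by (simp add: Compl_atMost)
  also have "\<dots> = 1 - measure_pmf.prob W {..N}"
    using measure_pmf.prob_compl[of "{..N}" W] by (simp add: Compl_eq_Diff_UNIV)
  finally show ?thesis by (simp add: measure_measure_pmf_finite)
qed

lemma sum_pmf_atMost_tendsto: "(\<lambda>N. \<Sum>k\<le>N. pmf W k) \<longlonglongrightarrow> 1"
proof -
  have "(\<lambda>N. measure_pmf.prob W {..N}) \<longlonglongrightarrow> measure_pmf.prob W (\<Union>N. {..N})"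
    by (intro measure_pmf.finite_Lim_measure_incseq) (auto simp: incseq_def)
  also have "(\<Union>N. {..N}) = (UNIV :: nat set)" by auto
  finally show ?thesis by (simp add: measure_measure_pmf_finite)
qed

text \<open>Both series are cut at \<open>N\<close>. The four error terms come from the change of
  law up to \<open>N\<close>, from sampling without replacement (k^2 \<le> N^2), and from the tails
  of the two laws. None of them depends on \<open>S\<close>.\<close>

lemma fourier_rho_diff_le:
  assumes "S \<subseteq> {1..n}" "N \<le> n" "n \<ge> 1"
  shows "\<bar>fourier n w S - rho W (1 - 2 * (card S / n))\<bar> \<le>
    (\<Sum>k\<le>N. \<bar>pmf w k - pmf W k\<bar>) + real N ^ 2 / n
      + (1 - (\<Sum>k\<le>N. pmf w k)) + (1 - (\<Sum>k\<le>N. pmf W k))"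
proof -
  define s where "s = 1 - 2 * (card S / n)"
  define K where "K k = esym_mean {1..n} (sign_on S) k" for k
  have "card S \<le> n" using card_mono[OF _ assms(1)] by simp
  then have s: "\<bar>s\<bar> \<le> 1" using assms(3) by (auto simp: s_def abs_le_iff field_simps)
  have "sum (sign_on S) {1..n} / card {1..n} = s"
    unfolding sum_sign_on[OF assms(1)] using assms(3) by (simp add: s_def diff_divide_distrib)
  then have Ks: "\<bar>K k - s ^ k\<bar> \<le> (real k)\<^sup>2 / n" if "k \<le> n" for k
    using abs_esym_mean_power_diff_le[of "{1..n}" "sign_on S" k] abs_sign_on_le_1[of S] that
    by (simp add: K_def)
  have K1: "\<bar>K k\<bar> \<le> 1" for k
    unfolding K_def by (intro abs_esym_mean_le_1 abs_sign_on_le_1) auto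
  have un: "{..n} = {..N} \<union> {N<..n}" using assms by auto
  have split: "(\<Sum>k\<le>n. f k) = (\<Sum>k\<le>N. f k) + (\<Sum>k\<in>{N<..n}. f k)" for f :: "nat \<Rightarrow> real"
    unfolding un by (intro sum.union_disjoint) auto
  have f: "fourier n w S = (\<Sum>k\<le>N. pmf w k * K k) + (\<Sum>k\<in>{N<..n}. pmf w k * K k)"
    unfolding fourier_def K_def by (rule split)
  have "\<bar>\<Sum>k\<in>{N<..n}. pmf w k * K k\<bar> \<le> (\<Sum>k\<in>{N<..n}. pmf w k * \<bar>K k\<bar>)"
    by (rule order_trans[OF sum_abs]) (simp add: abs_mult)
  also have "\<dots> \<le> (\<Sum>k\<in>{N<..n}. pmf w k * 1)" using K1 by (intro sum_mono mult_left_mono) auto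
  also have "\<dots> \<le> 1 - (\<Sum>k\<le>N. pmf w k)"
    using split[of "pmf w"] sum_pmf_le_1[of "{..n}" w] by simp
  finally have tail: "\<bar>\<Sum>k\<in>{N<..n}. pmf w k * K k\<bar> \<le> 1 - (\<Sum>k\<le>N. pmf w k)" .
  have "\<bar>(\<Sum>k\<le>N. pmf w k * K k) - (\<Sum>k\<le>N. pmf W k * s ^ k)\<bar>
      \<le> (\<Sum>k\<le>N. \<bar>pmf w k * K k - pmf W k * s ^ k\<bar>)"
    unfolding sum_subtractf[symmetric] by (rule sum_abs)
  also have "\<dots> \<le> (\<Sum>k\<le>N. \<bar>pmf w k - pmf W k\<bar> + pmf W k * ((real N)\<^sup>2 / n))"
  proof (rule sum_mono)
    fix k assume k: "k \<in> {..N}"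
    have "pmf w k * K k - pmf W k * s ^ k = (pmf w k - pmf W k) * K k + pmf W k * (K k - s ^ k)"
      by (simp add: algebra_simps)
    then have "\<bar>pmf w k * K k - pmf W k * s ^ k\<bar>
        \<le> \<bar>pmf w k - pmf W k\<bar> * \<bar>K k\<bar> + pmf W k * \<bar>K k - s ^ k\<bar>"
      using abs_triangle_ineq[of "(pmf w k - pmf W k) * K k" "pmf W k * (K k - s ^ k)"]
      by (simp add: abs_mult)
    also have "\<dots> \<le> \<bar>pmf w k - pmf W k\<bar> * 1 + pmf W k * ((real k)\<^sup>2 / n)"
      using K1 Ks[of k] k assms by (intro add_mono mult_left_mono) auto
    also have "\<dots> \<le> \<bar>pmf w k - pmf W k\<bar> + pmf W k * ((real N)\<^sup>2 / n)"
      using k by (auto intro!: mult_left_mono divide_right_mono power_mono)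
    finally show "\<bar>pmf w k * K k - pmf W k * s ^ k\<bar>
        \<le> \<bar>pmf w k - pmf W k\<bar> + pmf W k * ((real N)\<^sup>2 / n)" .
  qed
  also have "\<dots> = (\<Sum>k\<le>N. \<bar>pmf w k - pmf W k\<bar>) + (\<Sum>k\<le>N. pmf W k) * ((real N)\<^sup>2 / n)"
    by (simp only: sum.distrib sum_distrib_right)
  also have "\<dots> \<le> (\<Sum>k\<le>N. \<bar>pmf w k - pmf W k\<bar>) + 1 * ((real N)\<^sup>2 / n)"
    using sum_pmf_le_1[of "{..N}" W] by (intro add_left_mono mult_right_mono) auto
  finally show ?thesis
    using tail abs_rho_truncation_le[OF s, of W N] unfolding f s_def[symmetric] by linarith
qed

lemma fourier_uniform_limit:
  assumes "weak_conv_m (\<lambda>n. distr (measure_pmf (Wn n)) borel real) (distr (measure_pmf W) borel real)"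
    and "\<epsilon> > 0"
  shows "eventually (\<lambda>n. \<forall>S\<in>Pow {1..n}.
    \<bar>fourier n (Wn n) S - rho W (1 - 2 * (card S / n))\<bar> < \<epsilon>) sequentially"
proof -
  \<comment> \<open>In the limit the error bound contains the tail of \<open>W\<close> twice, once
    from each law; hence \<epsilon>/2.\<close>
  have "eventually (\<lambda>N. (\<Sum>k\<le>N. pmf W k) > 1 - \<epsilon> / 2) sequentially"
    using sum_pmf_atMost_tendsto[of W] assms(2) by (intro order_tendstoD) auto
  then obtain N where N: "(\<Sum>k\<le>N. pmf W k) > 1 - \<epsilon> / 2"
    by (auto simp: eventually_sequentially)
  have "(\<lambda>n. (\<Sum>k\<le>N. \<bar>pmf (Wn n) k - pmf W k\<bar>) + real N ^ 2 / real n
      + (1 - (\<Sum>k\<le>N. pmf (Wn n) k)) + (1 - (\<Sum>k\<le>N. pmf W k)))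
    \<longlonglongrightarrow> (\<Sum>k\<le>N. \<bar>pmf W k - pmf W k\<bar>) + 0
      + (1 - (\<Sum>k\<le>N. pmf W k)) + (1 - (\<Sum>k\<le>N. pmf W k))"
    by (intro tendsto_intros weak_conv_pmf[OF assms(1)] tendsto_divide_0[OF tendsto_const]
        filterlim_real_at_infinity_sequentially)
  then have "eventually (\<lambda>n. (\<Sum>k\<le>N. \<bar>pmf (Wn n) k - pmf W k\<bar>) + real N ^ 2 / real n
      + (1 - (\<Sum>k\<le>N. pmf (Wn n) k)) + (1 - (\<Sum>k\<le>N. pmf W k)) < \<epsilon>) sequentially"
    using N by (elim order_tendstoD(2)) simp
  moreover have "eventually (\<lambda>n. n \<ge> max N 1) sequentially" by (rule eventually_ge_at_top)
  ultimately show ?thesis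
  proof eventually_elim
    case (elim n)
    show ?case
    proof
      fix S assume "S \<in> Pow {1..n}"
      then show "\<bar>fourier n (Wn n) S - rho W (1 - 2 * (card S / n))\<bar> < \<epsilon>"
        using elim by (intro le_less_trans[OF fourier_rho_diff_le[where N=N] elim(1)]) auto
    qed
  qed
qed

section \<open>Upper and lower bounds\<close>

text \<open>The Fourier form of the probability that a random walk on {0,1}^n is back at the origin
  after \<open>m\<close> steps. The asymptotics are derived from it without reference to the
  probability spaces.\<close>

definition return_prob :: "nat \<Rightarrow> nat pmf \<Rightarrow> nat \<Rightarrow> real" where
  "return_prob n w m = (\<Sum>S\<in>Pow {1..n}. fourier n w S ^ m) / 2 ^ n"

text \<open>Powers of a base in [0,1] decrease in the exponent; this lemma and the next exchange
  \<open>m\<close> for a fixed real multiple of \<open>n\<close>. The condition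
  \<open>m \<ge> 1\<close> settles the base 0, where the left side has to vanish.\<close>

lemma power_le_powr_power:
  fixes x a :: real
  assumes "0 \<le> x" "x \<le> 1" "a * real n \<le> real m" "m \<ge> 1"
  shows "x ^ m \<le> (x powr a) ^ n"
proof (cases "x = 0")
  case False
  then have x: "x > 0" using assms by simp
  have "x ^ m = x powr real m" using x by (simp add: powr_realpow)
  also have "\<dots> \<le> x powr (a * real n)" using x assms by (intro powr_mono') auto
  also have "\<dots> = (x powr a) ^ n" using x by (simp add: powr_powr[symmetric] powr_realpow)
  finally show ?thesis .
qed (use assms in \<open>simp add: power_0_left\<close>)

lemma powr_power_le_power:
  fixes x b :: real
  assumes "0 < x" "x \<le> 1" "real m \<le> b * real n"
  shows "(x powr b) ^ n \<le> x ^ m"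
proof -
  have "(x powr b) ^ n = x powr (b * real n)"
    using assms(1) by (simp add: powr_powr[symmetric] powr_realpow)
  also have "\<dots> \<le> x powr real m" using assms by (intro powr_mono') auto
  also have "\<dots> = x ^ m" using assms(1) by (simp add: powr_realpow)
  finally show ?thesis .
qed

lemma sum_Pow_card: "(\<Sum>S\<in>Pow {1..n}. h (card S)) = (\<Sum>j\<le>n. real (n choose j) * h j)"
proof -
  have "(\<Sum>S\<in>Pow {1..n}. h (card S)) = (\<Sum>j\<le>n. \<Sum>S\<in>{S\<in>Pow {1..n}. card S = j}. h (card S))"
    using card_mono[of "{1..n}"] by (intro sum.group[symmetric]) auto
  also have "\<dots> = (\<Sum>j\<le>n. real (n choose j) * h j)"
    using n_subsets[of "{1..n}"] by (intro sum.cong) auto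
  finally show ?thesis .
qed

section \<open>The upper bound\<close>

lemma growth_tendsto:
  assumes "\<alpha> > 0"
  shows "(growth W \<longlongrightarrow> growth W \<alpha>) (at \<alpha>)"
  using continuous_on_growth[of W] assms by (simp add: continuous_on_def at_within_open[of _ "{0<..}"])

lemma eventually_return_prob_le:
  fixes \<alpha> \<eta> :: real
  assumes conv: "weak_conv_m (\<lambda>n. distr (measure_pmf (Wn n)) borel real) (distr (measure_pmf W) borel real)"
    and m_pos: "\<And>n. n \<ge> 1 \<Longrightarrow> m n \<ge> 1"
    and \<alpha>: "\<alpha> > 0" and m_lim: "(\<lambda>n. real (m n) / real n) \<longlonglongrightarrow> \<alpha>" and \<eta>: "\<eta> > 0"
  shows "eventually (\<lambda>n. return_prob n (Wn n) (m n) \<le> real (n + 1) * (growth W \<alpha> + \<eta>) ^ n) sequentially"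
proof -
  \<comment> \<open>Some a < \<alpha> is fixed whose growth is within \<eta>/2 of the target; then a
    n \<le> m(n) for all large n.\<close>
  have "eventually (\<lambda>a. growth W a < growth W \<alpha> + \<eta> / 2) (at_left \<alpha>)"
    using growth_tendsto[OF \<alpha>, of W] \<eta>
    by (intro order_tendstoD(2)[OF tendsto_mono[OF at_le]]) auto
  moreover have "eventually (\<lambda>a. a \<in> {0<..<\<alpha>}) (at_left \<alpha>)" by (rule eventually_at_left_real[OF \<alpha>])
  ultimately have "eventually (\<lambda>a. growth W a < growth W \<alpha> + \<eta> / 2 \<and> a \<in> {0<..<\<alpha>}) (at_left \<alpha>)"
    by (rule eventually_conj)
  then obtain a where a: "growth W a < growth W \<alpha> + \<eta> / 2" "0 < a" "a < \<alpha>"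
    using eventually_happens[of _ "at_left \<alpha>"] by (auto simp: trivial_limit_at_left_real)
  \<comment> \<open>Uniformity of the power function down to 0 lets one \<epsilon> serve all levels,
    including those where \<open>rho\<close> is near 0. The interval reaches 2 because r \<le> 1 is
    shifted by \<epsilon> \<le> 1.\<close>
  have "uniformly_continuous_on {0..2} (\<lambda>r::real. r powr a)"
    using a by (intro compact_uniformly_continuous continuous_on_powr' continuous_intros) auto
  then obtain d where d: "d > 0"
    "\<And>r r' :: real. r \<in> {0..2} \<Longrightarrow> r' \<in> {0..2} \<Longrightarrow> dist r' r < d \<Longrightarrow> dist (r' powr a) (r powr a) < \<eta> / 2"
    unfolding uniformly_continuous_on_def using \<eta> by (metis half_gt_zero)
  define \<epsilon> where "\<epsilon> = min 1 (d / 2)"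
  have \<epsilon>: "0 < \<epsilon>" "\<epsilon> \<le> 1" "\<epsilon> < d" using d(1) by (auto simp: \<epsilon>_def)
  have shift: "(r + \<epsilon>) powr a \<le> r powr a + \<eta> / 2" if "0 \<le> r" "r \<le> 1" for r
  proof -
    have "dist ((r + \<epsilon>) powr a) (r powr a) < \<eta> / 2"
      using d(2)[of r "r + \<epsilon>"] that \<epsilon> by (simp add: dist_real_def)
    then show ?thesis unfolding dist_real_def by linarith
  qed
  have "eventually (\<lambda>n. a < real (m n) / real n) sequentially"
    using a by (intro order_tendstoD(1)[OF m_lim]) auto
  moreover note fourier_uniform_limit[OF conv \<epsilon>(1)]
  moreover have "eventually (\<lambda>n. n \<ge> 1) sequentially" by (rule eventually_ge_at_top)
  ultimately show ?thesis
  proof eventually_elim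
    case (elim n)
    then have n: "n \<ge> 1" and mn: "a * real n \<le> real (m n)"
      by (auto simp: field_simps)
    define B where "B j = rho W \<bar>1 - 2 * (real j / n)\<bar> powr a + \<eta> / 2" for j
    have term_le: "fourier n (Wn n) S ^ m n \<le> B (card S) ^ n" if S: "S \<in> Pow {1..n}" for S
    proof -
      define \<sigma> where "\<sigma> = 1 - 2 * (real (card S) / n)"
      have "card S \<le> n" using card_mono[of "{1..n}" S] S by simp
      then have \<sigma>: "\<bar>\<sigma>\<bar> \<le> 1" using n by (auto simp: \<sigma>_def abs_le_iff field_simps)
      have r: "0 \<le> rho W \<bar>\<sigma>\<bar>" "rho W \<bar>\<sigma>\<bar> \<le> 1"
        using \<sigma> rho_nonneg[of "\<bar>\<sigma>\<bar>" W] abs_rho_le_1[of "\<bar>\<sigma>\<bar>" W] by auto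
      have "\<bar>fourier n (Wn n) S - rho W \<sigma>\<bar> < \<epsilon>" using elim(2) S by (simp add: \<sigma>_def)
      then have f: "\<bar>fourier n (Wn n) S\<bar> \<le> rho W \<bar>\<sigma>\<bar> + \<epsilon>"
        using abs_rho_le_rho_abs[OF \<sigma>, of W] by linarith
      have "fourier n (Wn n) S ^ m n \<le> \<bar>fourier n (Wn n) S\<bar> ^ m n"
        unfolding power_abs[symmetric] by (rule abs_ge_self)
      also have "\<dots> \<le> (\<bar>fourier n (Wn n) S\<bar> powr a) ^ n"
        using abs_fourier_le_1 mn m_pos[OF n] by (intro power_le_powr_power) auto
      also have "\<dots> \<le> ((rho W \<bar>\<sigma>\<bar> + \<epsilon>) powr a) ^ n"
        using f a by (intro power_mono powr_mono2) auto
      also have "\<dots> \<le> B (card S) ^ n"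
        unfolding B_def \<sigma>_def[symmetric] using shift[OF r] by (intro power_mono) auto
      finally show ?thesis .
    qed
    have level_le: "real (n choose j) * B j ^ n / 2 ^ n \<le> (growth W \<alpha> + \<eta>) ^ n" if j: "j \<le> n" for j
    proof -
      define x where "x = real j / n"
      \<comment> \<open>Reflection folds the levels beyond n/2 into [0,1/2]; entropy and |1 - 2x|
        are invariant under it.\<close>
      define \<gamma> where "\<gamma> = min x (1 - x)"
      have x: "0 \<le> x" "x \<le> 1" using j n by (auto simp: x_def)
      then have \<gamma>: "\<gamma> \<in> {0..1/2}" "\<bar>1 - 2 * x\<bar> = 1 - 2 * \<gamma>" by (auto simp: \<gamma>_def min_def)
      have q: "self_pow x = self_pow \<gamma>" by (auto simp: \<gamma>_def min_def self_pow_commute)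
      have q2: "1 \<le> 2 * self_pow x" using self_pow_bounds[OF x] by simp
      have B0: "0 \<le> B j" using \<eta> by (auto simp: B_def)
      have "real (n choose j) * self_pow x ^ n \<le> 1"
        unfolding x_def by (rule binomial_self_pow_le_1[OF j n])
      then have "real (n choose j) \<le> 1 / self_pow x ^ n"
        using q2 by (simp add: field_simps)
      then have "real (n choose j) * B j ^ n / 2 ^ n \<le> 1 / self_pow x ^ n * B j ^ n / 2 ^ n"
        using B0 by (intro divide_right_mono mult_right_mono) auto
      also have "\<dots> = (B j / (2 * self_pow x)) ^ n" by (simp add: power_divide power_mult_distrib)
      also have "\<dots> \<le> (growth W \<alpha> + \<eta>) ^ n"
      proof (rule power_mono)
        have "B j / (2 * self_pow x) = fibre_growth W a \<gamma> + \<eta> / 2 / (2 * self_pow x)"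
          by (simp add: B_def x_def[symmetric] \<gamma>(2) fibre_growth_def q add_divide_distrib)
        also have "\<dots> \<le> growth W a + \<eta> / 2"
          using fibre_growth_le_growth[OF a(2) \<gamma>(1), of W] q2 \<eta>
          by (intro add_mono) (auto simp: divide_le_eq)
        finally show "B j / (2 * self_pow x) \<le> growth W \<alpha> + \<eta>" using a(1) by simp
      qed (use B0 q2 in auto)
      finally show ?thesis .
    qed
    have "return_prob n (Wn n) (m n) \<le> (\<Sum>S\<in>Pow {1..n}. B (card S) ^ n) / 2 ^ n"
      unfolding return_prob_def using term_le by (intro divide_right_mono sum_mono) auto
    also have "\<dots> = (\<Sum>j\<le>n. real (n choose j) * B j ^ n / 2 ^ n)"
      using sum_Pow_card[of "\<lambda>j. B j ^ n" n] by (simp add: sum_divide_distrib)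
    also have "\<dots> \<le> (\<Sum>j\<le>n. (growth W \<alpha> + \<eta>) ^ n)"
      using level_le by (intro sum_mono) auto
    finally show ?case by simp
  qed
qed

section \<open>The lower bound: pairing a set with its complement\<close>

lemma sum_powers_nonneg:
  fixes x y :: real
  assumes "even m \<or> 0 \<le> x + y"
  shows "0 \<le> x ^ m + y ^ m"
proof (cases "even m")
  case False
  then have "(- x) ^ m \<le> y ^ m" using assms by (intro power_mono_odd) auto
  then show ?thesis using False by simp
qed (simp add: zero_le_even_power)

text \<open>Only odd \<open>m\<close> with y < 0 can cause cancellation. Then c \<le> x + y and c x
  \<le> c give -y \<le> (1 - c) x, so y^m removes at most the fraction (1 - c)^m \<le> 1 - c of x^m.
  The surviving fraction c does not depend on \<open>m\<close>.\<close>

lemma sum_powers_ge: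
  fixes x y c :: real
  assumes "0 \<le> x" "x \<le> 1" "0 \<le> c" "c \<le> 1" "m \<ge> 1" "even m \<or> c \<le> x + y"
  shows "c * x ^ m \<le> x ^ m + y ^ m"
proof (cases "even m \<or> 0 \<le> y")
  case True
  then have "0 \<le> y ^ m" by (auto simp: zero_le_even_power)
  moreover have "c * x ^ m \<le> 1 * x ^ m" using assms by (intro mult_right_mono) auto
  ultimately show ?thesis by simp
next
  case False
  then have odd: "odd m" and y: "y < 0" and xy: "c \<le> x + y" using assms by auto
  have "c * x \<le> c * 1" using assms by (intro mult_left_mono) auto
  then have le: "- y \<le> (1 - c) * x" using xy by (simp add: left_diff_distrib)
  have "- (y ^ m) = (- y) ^ m" using odd by simp
  also have "\<dots> \<le> ((1 - c) * x) ^ m" using le y by (intro power_mono) auto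
  also have "\<dots> = (1 - c) ^ m * x ^ m" by (rule power_mult_distrib)
  also have "\<dots> \<le> (1 - c) ^ 1 * x ^ m"
    using assms by (intro mult_right_mono power_decreasing) auto
  finally show ?thesis by (simp add: left_diff_distrib)
qed

lemma floor_div_tendsto:
  assumes "0 \<le> \<gamma>"
  shows "(\<lambda>n. real (nat \<lfloor>\<gamma> * real n\<rfloor>) / real n) \<longlonglongrightarrow> \<gamma>"
proof (rule tendsto_sandwich)
  show "eventually (\<lambda>n. \<gamma> - 1 / real n \<le> real (nat \<lfloor>\<gamma> * real n\<rfloor>) / real n) sequentially"
    using eventually_ge_at_top[of 1]
  proof eventually_elim
    case (elim n)
    have "\<gamma> * real n - 1 \<le> real (nat \<lfloor>\<gamma> * real n\<rfloor>)" using assms by linarith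
    then have "(\<gamma> * real n - 1) / real n \<le> real (nat \<lfloor>\<gamma> * real n\<rfloor>) / real n"
      by (rule divide_right_mono) simp
    then show ?case using elim by (simp add: diff_divide_distrib)
  qed
  show "eventually (\<lambda>n. real (nat \<lfloor>\<gamma> * real n\<rfloor>) / real n \<le> \<gamma>) sequentially"
    using eventually_ge_at_top[of 1]
  proof eventually_elim
    case (elim n)
    have "real (nat \<lfloor>\<gamma> * real n\<rfloor>) \<le> \<gamma> * real n" using assms by simp
    then show ?case using elim by (simp add: divide_le_eq)
  qed
  show "(\<lambda>n. \<gamma> - 1 / real n) \<longlonglongrightarrow> \<gamma>"
    by (rule tendsto_eq_rhs[OF tendsto_diff[OF tendsto_const lim_1_over_n]]) simp
qed simp

text \<open>The two alternative hypotheses are merged. If every m(n) is even, the constants are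
  arbitrary; otherwise \<open>k\<close> is an even atom of \<open>W\<close> and \<open>p\<close> its
  mass.\<close>

lemma parity_witness:
  assumes "(\<forall>n\<ge>1. even (m n)) \<or> measure_pmf.prob W {k. even k} > 0"
  obtains p :: real and k :: nat where "0 < p" "p \<le> 1"
    "\<And>n s. n \<ge> 1 \<Longrightarrow> 0 \<le> s \<Longrightarrow> s \<le> 1 \<Longrightarrow> even (m n :: nat) \<or> 2 * (p * s ^ k) \<le> rho W s + rho W (- s)"
proof (cases "\<forall>n\<ge>1. even (m n)")
  case True
  then show ?thesis using that[of 1 0] by auto
next
  case False
  then have "measure_pmf.prob W {k. even k} \<noteq> 0" using assms by (metis less_irrefl)
  then obtain k where "k \<in> set_pmf W" "even k"
    by (auto simp: measure_pmf_zero_iff)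
  then show ?thesis using that[of "pmf W k" k] rho_even_part_ge[of _ k W]
    by (simp add: pmf_positive pmf_le_1)
qed

text \<open>Complementation permutes the subsets, so twice the sum is a sum over pairs. Level
  \<open>j\<close> provides the main term; the possible loss of 2 \<delta>^m per set becomes
  \<delta>^m after division by 2 * 2^n.\<close>

lemma return_prob_ge:
  fixes \<delta> \<mu> c :: real
  assumes level: "\<And>S. S \<subseteq> {1..n} \<Longrightarrow> card S = j \<Longrightarrow>
      c * \<mu> ^ m \<le> fourier n w S ^ m + fourier n w ({1..n} - S) ^ m"
    and all: "\<And>S. S \<subseteq> {1..n} \<Longrightarrow>
      - 2 * \<delta> ^ m \<le> fourier n w S ^ m + fourier n w ({1..n} - S) ^ m"
    and "0 \<le> \<delta>" "j \<le> n"
  shows "c / 2 * \<mu> ^ m * real (n choose j) / 2 ^ n - \<delta> ^ m \<le> return_prob n w m"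
proof -
  let ?f = "\<lambda>S. fourier n w S ^ m"
  let ?N = "{1..n}"
  have "(\<Sum>S\<in>Pow ?N. ?f (?N - S)) = (\<Sum>S\<in>Pow ?N. ?f S)"
    by (rule sum.reindex_bij_witness[where i="\<lambda>S. ?N - S" and j="\<lambda>S. ?N - S"])
      (auto simp: double_diff)
  then have pair: "2 * (\<Sum>S\<in>Pow ?N. ?f S) = (\<Sum>S\<in>Pow ?N. ?f S + ?f (?N - S))"
    by (simp add: sum.distrib)
  have dm: "0 \<le> \<delta> ^ m" using assms by simp
  have "real (n choose j) * (c * \<mu> ^ m) - 2 ^ n * (2 * \<delta> ^ m)
      = (\<Sum>i\<le>n. real (n choose i) * (if i = j then c * \<mu> ^ m else 0)) - 2 ^ n * (2 * \<delta> ^ m)"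
    using assms(4) by (simp add: if_distrib[of "\<lambda>y. _ * y"] sum.delta cong: if_cong)
  also have "\<dots> = (\<Sum>S\<in>Pow ?N. (if card S = j then c * \<mu> ^ m else 0) - 2 * \<delta> ^ m)"
    unfolding sum_Pow_card[symmetric, of n "\<lambda>i. if i = j then c * \<mu> ^ m else 0"]
    by (simp add: sum_subtractf card_Pow)
  also have "\<dots> \<le> (\<Sum>S\<in>Pow ?N. ?f S + ?f (?N - S))"
  proof (rule sum_mono)
    fix S assume "S \<in> Pow ?N"
    then show "(if card S = j then c * \<mu> ^ m else 0) - 2 * \<delta> ^ m \<le> ?f S + ?f (?N - S)"
      using level[of S] all[of S] dm by auto
  qed
  finally have "(real (n choose j) * (c * \<mu> ^ m) - 2 ^ n * (2 * \<delta> ^ m)) / (2 * 2 ^ n)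
      \<le> (2 * (\<Sum>S\<in>Pow ?N. ?f S)) / (2 * 2 ^ n)"
    unfolding pair by (rule divide_right_mono) simp
  then show ?thesis by (simp add: return_prob_def diff_divide_distrib mult_ac)
qed


lemma eventually_return_prob_ge:
  fixes \<alpha> \<eta> :: real and m :: "nat \<Rightarrow> nat"
  assumes W_pos: "set_pmf W \<subseteq> {1..}"
    and conv: "weak_conv_m (\<lambda>n. distr (measure_pmf (Wn n)) borel real) (distr (measure_pmf W) borel real)"
    and m_pos: "\<And>n. n \<ge> 1 \<Longrightarrow> m n \<ge> 1"
    and \<alpha>: "\<alpha> > 0" and m_lim: "(\<lambda>n. real (m n) / real n) \<longlonglongrightarrow> \<alpha>"
    and parity: "(\<forall>n\<ge>1. even (m n)) \<or> measure_pmf.prob W {k. even k} > 0"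
    and \<eta>: "0 < \<eta>" "\<eta> \<le> 1/4"
  obtains c where "c > 0"
    "eventually (\<lambda>n. c / real (n + 1) * (growth W \<alpha> - \<eta>) ^ n \<le> return_prob n (Wn n) (m n)) sequentially"
proof -
  let ?G = "growth W \<alpha>"
  have G: "1/2 \<le> ?G" by (rule growth_ge_half[OF \<alpha>])
  \<comment> \<open>Dual to the upper bound: b > \<alpha> with m(n) \<le> b n for all large n,
    followed by a nearly optimal level \<gamma> for b.\<close>
  have "eventually (\<lambda>b. ?G - \<eta> / 3 < growth W b) (at_right \<alpha>)"
    using growth_tendsto[OF \<alpha>, of W] \<eta>
    by (intro order_tendstoD(1)[OF tendsto_mono[OF at_le]]) auto
  moreover have "eventually (\<lambda>b. \<alpha> < b) (at_right \<alpha>)" by (rule eventually_at_right_less)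
  ultimately have "eventually (\<lambda>b. ?G - \<eta> / 3 < growth W b \<and> \<alpha> < b) (at_right \<alpha>)"
    by (rule eventually_conj)
  then obtain b where b: "?G - \<eta> / 3 < growth W b" "\<alpha> < b"
    using eventually_happens[of _ "at_right \<alpha>"] by (auto simp: trivial_limit_at_right_real)
  have b0: "b > 0" using b \<alpha> by simp
  obtain \<gamma> where \<gamma>: "\<gamma> \<in> {0..1/2}" "?G - \<eta> / 3 < fibre_growth W b \<gamma>"
    using b(1) unfolding growth_def[of W b] by (rule less_cSupE) auto
  define s where "s = 1 - 2 * \<gamma>"
  \<comment> \<open>At \<gamma> = 1/2 the quotient is 0, because W \<ge> 1 gives \<rho>(0) = 0.
    Excluding this value makes \<open>s\<close>, and with it the pairing constant \<open>c\<close>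
    below, positive.\<close>
  have "\<gamma> \<noteq> 1/2"
  proof
    assume half: "\<gamma> = 1/2"
    have "rho W 0 = 0" using rho_le_self[OF W_pos, of 0] rho_nonneg[of 0 W] by simp
    then have "fibre_growth W b (1/2) = 0" by (simp add: fibre_growth_def)
    then show False using \<gamma>(2) G \<eta> unfolding half by simp
  qed
  then have s: "0 < s" "s \<le> 1" using \<gamma>(1) by (auto simp: s_def)
  obtain p k where p: "0 < p" "p \<le> 1" and pair:
    "\<And>n s. n \<ge> 1 \<Longrightarrow> 0 \<le> s \<Longrightarrow> s \<le> 1 \<Longrightarrow> even (m n) \<or> 2 * (p * s ^ k) \<le> rho W s + rho W (- s)"
    using parity_witness[OF parity] by metis
  \<comment> \<open>Chosen so that \<delta>^m \<le> 8^(-n) once m \<ge> \<alpha> n / 2. As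
    \<open>?G - \<eta>\<close> is at least 1/4, pairs of size \<delta>^m are then negligible even
    after multiplication by polynomial factors.\<close>
  define \<delta> :: real where "\<delta> = (1/8) powr (2 / \<alpha>)"
  have \<delta>: "0 < \<delta>" "\<delta> \<le> 1" using \<alpha> by (auto simp: \<delta>_def intro!: powr_le1)
  have \<delta>_pow: "\<delta> powr (\<alpha> / 2) = 1/8" using \<alpha> by (simp add: \<delta>_def powr_powr)
  define c where "c = p * s ^ k"
  have c: "0 < c" "c \<le> 1"
    using p s by (auto simp: c_def intro!: mult_le_one power_le_one)
  define c' where "c' = p * (\<delta> / 2) ^ k"
  have c': "0 < c'" using p \<delta> by (simp add: c'_def)
  define q where "q = self_pow \<gamma>"
  have q: "1/2 \<le> q" using self_pow_bounds[of \<gamma>] \<gamma>(1) by (simp add: q_def)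
  have r: "0 < rho W s" using rho_pos[OF s] .
  have "((\<lambda>\<epsilon>. (rho W s - \<epsilon>) powr b / (2 * q)) \<longlongrightarrow> (rho W s - 0) powr b / (2 * q)) (at_right 0)"
    using r q by (intro tendsto_intros) auto
  moreover have "?G - \<eta> < (rho W s - 0) powr b / (2 * q)"
    using \<gamma>(2) \<eta> by (simp add: fibre_growth_def s_def q_def)
  ultimately have "eventually (\<lambda>\<epsilon>. ?G - \<eta> < (rho W s - \<epsilon>) powr b / (2 * q)) (at_right 0)"
    by (rule order_tendstoD)
  \<comment> \<open>The four bounds keep, in turn, the base \<open>rho W s - \<epsilon>\<close>
    positive, coefficients with |1 - 2|S|/n| < \<delta>/2 within \<delta>, the pair sums on the
    chosen level at least \<open>c\<close> for odd \<open>m\<close>, and the pair sums away from n/2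
    nonnegative for odd \<open>m\<close>.\<close>
  moreover have "eventually (\<lambda>\<epsilon>::real. \<epsilon> \<in> {0<..<Min {rho W s, \<delta> / 2, c / 2, c'}}) (at_right 0)"
    using r \<delta> c c' by (intro eventually_at_right_real) auto
  ultimately have "eventually (\<lambda>\<epsilon>. ?G - \<eta> < (rho W s - \<epsilon>) powr b / (2 * q) \<and>
      \<epsilon> \<in> {0<..<Min {rho W s, \<delta> / 2, c / 2, c'}}) (at_right 0)"
    by (rule eventually_conj)
  then obtain \<epsilon> where \<epsilon>: "?G - \<eta> < (rho W s - \<epsilon>) powr b / (2 * q)"
    "0 < \<epsilon>" "\<epsilon> < rho W s" "\<epsilon> < \<delta> / 2" "\<epsilon> < c / 2" "\<epsilon> < c'"
    using eventually_happens[of _ "at_right (0::real)"] by (auto simp: trivial_limit_at_right_real)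
  \<comment> \<open>Rounding down matters: it gives 1 - 2 j/n \<ge> s, so the pairing constant
    belonging to \<open>s\<close> is valid on this level.\<close>
  define j where "j n = nat \<lfloor>\<gamma> * real n\<rfloor>" for n
  define x where "x n = real (j n) / real n" for n
  define \<mu> where "\<mu> n = rho W (1 - 2 * x n) - \<epsilon>" for n
  have x_lim: "x \<longlonglongrightarrow> \<gamma>"
    unfolding x_def[abs_def] j_def using \<gamma>(1) by (intro floor_div_tendsto) auto
  have j_le: "real (j n) \<le> \<gamma> * real n" for n
    using \<gamma>(1) by (simp add: j_def)
  have x: "0 \<le> x n" "x n \<le> \<gamma>" for n
    using j_le[of n] \<gamma>(1) by (auto simp: x_def divide_le_eq)
  have "(\<lambda>n. rho W (1 - 2 * x n)) \<longlonglongrightarrow> rho W s"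
    using x \<gamma>(1) x_lim
    by (intro continuous_on_tendsto_compose[OF continuous_on_rho])
      (auto simp: s_def intro!: tendsto_intros always_eventually order_trans[OF x(2)])
  then have \<mu>_lim: "\<mu> \<longlonglongrightarrow> rho W s - \<epsilon>"
    unfolding \<mu>_def[abs_def] by (intro tendsto_intros)
  have "(\<lambda>n. self_pow (x n)) \<longlonglongrightarrow> q"
    unfolding q_def using x \<gamma>(1) x_lim
    by (intro continuous_on_tendsto_compose[OF continuous_on_self_pow])
      (auto intro!: always_eventually order_trans[OF x(2)])
  then have "(\<lambda>n. \<mu> n powr b / (2 * self_pow (x n))) \<longlonglongrightarrow> (rho W s - \<epsilon>) powr b / (2 * q)"
    using \<mu>_lim q \<epsilon>(3) by (intro tendsto_intros) auto
  then have ev1: "eventually (\<lambda>n. ?G - \<eta> < \<mu> n powr b / (2 * self_pow (x n))) sequentially"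
    using \<epsilon>(1) by (rule order_tendstoD)
  have ev2: "eventually (\<lambda>n. 0 < \<mu> n) sequentially"
    using \<mu>_lim \<epsilon>(3) by (intro order_tendstoD(1)[OF \<mu>_lim]) simp
  have ev3: "eventually (\<lambda>n. real (m n) / real n < b) sequentially"
    by (rule order_tendstoD(2)[OF m_lim b(2)])
  have ev4: "eventually (\<lambda>n. \<alpha> / 2 < real (m n) / real n) sequentially"
    using \<alpha> by (intro order_tendstoD(1)[OF m_lim]) simp
  have ev5: "eventually (\<lambda>n. real (n + 1) * (1/2) ^ n < c / 4) sequentially"
  proof -
    have "(\<lambda>n. real (n + 1) * (1/2) ^ n) \<longlonglongrightarrow> 0" by real_asymp
    then show ?thesis using c by (intro order_tendstoD(2)) auto
  qed
  have "eventually (\<lambda>n. c / 4 / real (n + 1) * (?G - \<eta>) ^ n \<le> return_prob n (Wn n) (m n)) sequentially"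
    using ev1 ev2 ev3 ev4 ev5 fourier_uniform_limit[OF conv \<epsilon>(2)] eventually_ge_at_top[of 1]
  proof eventually_elim
    case (elim n)
    note n = \<open>1 \<le> n\<close>
    have mb: "real (m n) \<le> b * real n" using elim(3) n by (simp add: divide_less_eq)
    have ma: "\<alpha> / 2 * real n \<le> real (m n)" using elim(4) n by (simp add: less_divide_eq)
    have m1: "m n \<ge> 1" using m_pos[OF n] .
    have jn: "j n \<le> n"
    proof -
      have "\<gamma> * real n \<le> 1 * real n" using \<gamma>(1) by (intro mult_right_mono) auto
      then have "real (j n) \<le> real n" using j_le[of n] by simp
      then show ?thesis by simp
    qed
    let ?f = "fourier n (Wn n)"
    define \<sigma> where "\<sigma> S = 1 - 2 * (real (card S) / n)" for S :: "nat set"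
    have near: "\<bar>?f S - rho W (\<sigma> S)\<bar> < \<epsilon>" "\<bar>?f ({1..n} - S) - rho W (- \<sigma> S)\<bar> < \<epsilon>" "\<bar>\<sigma> S\<bar> \<le> 1"
      if S: "S \<subseteq> {1..n}" for S
    proof -
      have cS: "card S \<le> n" using card_mono[of "{1..n}" S] S by simp
      have "card ({1..n} - S) = n - card S"
        using S by (subst card_Diff_subset) (auto intro: finite_subset)
      then have "\<sigma> ({1..n} - S) = - \<sigma> S"
        using cS n by (simp add: \<sigma>_def of_nat_diff field_simps)
      then show "\<bar>?f ({1..n} - S) - rho W (- \<sigma> S)\<bar> < \<epsilon>"
        using elim(6) unfolding \<sigma>_def by (metis Diff_subset PowI)
      show "\<bar>?f S - rho W (\<sigma> S)\<bar> < \<epsilon>" using elim(6) S by (simp add: \<sigma>_def)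
      show "\<bar>\<sigma> S\<bar> \<le> 1" using cS n by (auto simp: \<sigma>_def abs_le_iff field_simps)
    qed
    have ge: "even (m n) \<or> 2 * (p * t ^ k) - 2 * \<epsilon> \<le> ?f S + ?f ({1..n} - S)"
      if S: "S \<subseteq> {1..n}" and t: "0 \<le> t" "t \<le> \<bar>\<sigma> S\<bar>" for S t
    proof -
      \<comment> \<open>The sum is symmetric under a change of sign, so a set and its complement are
        treated alike through |\<sigma>|.\<close>
      have "rho W (\<sigma> S) + rho W (- \<sigma> S) = rho W \<bar>\<sigma> S\<bar> + rho W (- \<bar>\<sigma> S\<bar>)"
        by (simp add: abs_if)
      then have "even (m n) \<or> 2 * (p * \<bar>\<sigma> S\<bar> ^ k) \<le> rho W (\<sigma> S) + rho W (- \<sigma> S)"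
        using pair[OF n, of "\<bar>\<sigma> S\<bar>"] near(3)[OF S] by simp
      moreover have "p * t ^ k \<le> p * \<bar>\<sigma> S\<bar> ^ k"
        using p t by (intro mult_left_mono power_mono) auto
      ultimately show ?thesis
        using near(1,2)[OF S] unfolding abs_less_iff by linarith
    qed
    have level: "c * \<mu> n ^ m n \<le> ?f S ^ m n + ?f ({1..n} - S) ^ m n"
      if S: "S \<subseteq> {1..n}" and "card S = j n" for S
    proof -
      have \<sigma>: "\<sigma> S = 1 - 2 * x n" using that by (simp add: \<sigma>_def x_def)
      then have "s \<le> \<sigma> S" using x(2)[of n] by (simp add: s_def)
      then have sum: "even (m n) \<or> c \<le> ?f S + ?f ({1..n} - S)"
        using ge[OF S, of s] s \<epsilon>(5) by (auto simp: c_def)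
      have f: "\<mu> n \<le> ?f S" using near(1)[OF S] by (simp add: \<mu>_def \<sigma>)
      have "c * \<mu> n ^ m n \<le> c * ?f S ^ m n"
        using f elim(2) c by (intro mult_left_mono power_mono) auto
      also have "\<dots> \<le> ?f S ^ m n + ?f ({1..n} - S) ^ m n"
        using f elim(2) c sum m1 abs_fourier_le_1[of n "Wn n" S] by (intro sum_powers_ge) auto
      finally show ?thesis .
    qed
    have all: "- 2 * \<delta> ^ m n \<le> ?f S ^ m n + ?f ({1..n} - S) ^ m n" if S: "S \<subseteq> {1..n}" for S
    \<comment> \<open>Away from n/2 the parity hypothesis makes the pair nonnegative. Near n/2 no
      sign is available, but |\<rho>(t)| \<le> |t| makes both coefficients at most \<delta> in
      absolute value.\<close>
    proof (cases "\<delta> / 2 \<le> \<bar>\<sigma> S\<bar>")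
      case True
      then have "even (m n) \<or> 0 \<le> ?f S + ?f ({1..n} - S)"
        using ge[OF S, of "\<delta> / 2"] \<delta> \<epsilon>(6) by (auto simp: c'_def)
      then have "0 \<le> ?f S ^ m n + ?f ({1..n} - S) ^ m n" by (rule sum_powers_nonneg)
      moreover have "0 \<le> \<delta> ^ m n" using \<delta> by simp
      ultimately show ?thesis by linarith
    next
      case False
      have small: "- (\<delta> ^ m n) \<le> y ^ m n" if "\<bar>y - rho W t\<bar> < \<epsilon>" "\<bar>t\<bar> = \<bar>\<sigma> S\<bar>" for y t
      proof -
        have "\<bar>rho W t\<bar> \<le> \<bar>t\<bar>"
          using abs_rho_le_rho_abs[of t W] rho_le_self[OF W_pos, of "\<bar>t\<bar>"] near(3)[OF S] that(2) by simp
        then have "\<bar>y\<bar> \<le> \<delta>" using that False \<epsilon>(4) by simp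
        then have "\<bar>y ^ m n\<bar> \<le> \<delta> ^ m n" unfolding power_abs by (intro power_mono) auto
        then show ?thesis by linarith
      qed
      show ?thesis using small[OF near(1)[OF S]] small[OF near(2)[OF S]] by simp
    qed
    define L where "L = ?G - \<eta>"
    have L: "1/4 \<le> L" using G \<eta> by (simp add: L_def)
    have q': "1/2 \<le> self_pow (x n)" using self_pow_bounds[of "x n"] x[of n] \<gamma>(1) by auto
    have \<mu>1: "\<mu> n \<le> 1"
      using abs_rho_le_1[of "1 - 2 * x n" W] x[of n] \<gamma>(1) \<epsilon>(2) by (auto simp: \<mu>_def)
    \<comment> \<open>The level contains enough sets: its binomial coefficient reaches the entropy
      bound up to the factor n + 1.\<close>
    have "1 / self_pow (x n) ^ n \<le> real (n + 1) * real (n choose j n)"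
      using binomial_self_pow_ge[OF jn n] q' unfolding x_def[symmetric]
      by (simp add: divide_le_eq mult.assoc)
    have "L ^ n \<le> (\<mu> n powr b / (2 * self_pow (x n))) ^ n"
      using elim(1) L by (intro power_mono) (auto simp: L_def)
    also have "\<dots> = (\<mu> n powr b) ^ n * (1 / self_pow (x n) ^ n) / 2 ^ n"
      by (simp add: power_divide power_mult_distrib)
    also have "\<dots> \<le> \<mu> n ^ m n * (real (n + 1) * real (n choose j n)) / 2 ^ n"
      using powr_power_le_power[OF elim(2) \<mu>1 mb] \<open>1 / self_pow (x n) ^ n \<le> _\<close> elim(2) q'
      by (intro divide_right_mono mult_mono) auto
    finally have "c / 2 / real (n + 1) * L ^ n
        \<le> c / 2 / real (n + 1) * (\<mu> n ^ m n * (real (n + 1) * real (n choose j n)) / 2 ^ n)"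
      using c by (intro mult_left_mono) auto
    also have "\<dots> = c / 2 * \<mu> n ^ m n * real (n choose j n) / 2 ^ n"
    proof -
      have cancel: "c / 2 / N * (y * (N * z) / w) = c / 2 * y * z / w" if "N \<noteq> 0" for N y z w :: real
        using that by simp
      show ?thesis by (rule cancel) simp
    qed
    finally have main: "c / 2 / real (n + 1) * L ^ n \<le> c / 2 * \<mu> n ^ m n * real (n choose j n) / 2 ^ n" .
    \<comment> \<open>The negative contribution takes at most half of the main term, which explains
      the final constant c/4 against c/2.\<close>
    have "\<delta> ^ m n \<le> (\<delta> powr (\<alpha> / 2)) ^ n"
      using \<delta> ma m1 by (intro power_le_powr_power) auto
    also have "\<dots> = (1/2) ^ n * (1/4) ^ n" unfolding \<delta>_pow by (simp add: power_mult_distrib[symmetric])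
    also have "\<dots> \<le> (1/2) ^ n * L ^ n" using L by (intro mult_left_mono power_mono) auto
    also have "\<dots> \<le> c / 4 / real (n + 1) * L ^ n"
      using elim(5) L by (intro mult_right_mono) (auto simp: field_simps)
    finally have "\<delta> ^ m n \<le> c / 4 / real (n + 1) * L ^ n" .
    moreover have "c / 2 / N * y = 2 * (c / 4 / N * y)" for N y :: real by (simp add: divide_simps)
    from this[of "real (n + 1)" "L ^ n"]
    have "c / 2 / real (n + 1) * L ^ n = 2 * (c / 4 / real (n + 1) * L ^ n)" .
    ultimately have "c / 4 / real (n + 1) * L ^ n \<le> c / 2 * \<mu> n ^ m n * real (n choose j n) / 2 ^ n - \<delta> ^ m n"
      using main by linarith
    also have "\<dots> \<le> return_prob n (Wn n) (m n)"
      using \<delta> by (intro return_prob_ge level all jn) auto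
    finally show ?case by (simp add: L_def)
  qed
  then show thesis using that[of "c / 4"] c by simp
qed

section \<open>Passage to the logarithmic limit\<close>

lemma return_prob_limit:
  fixes \<alpha> :: real and m :: "nat \<Rightarrow> nat"
  assumes W_pos: "set_pmf W \<subseteq> {1..}"
    and conv: "weak_conv_m (\<lambda>n. distr (measure_pmf (Wn n)) borel real) (distr (measure_pmf W) borel real)"
    and m_pos: "\<And>n. n \<ge> 1 \<Longrightarrow> m n \<ge> 1"
    and \<alpha>: "\<alpha> > 0" and m_lim: "(\<lambda>n. real (m n) / real n) \<longlonglongrightarrow> \<alpha>"
    and parity: "(\<forall>n\<ge>1. even (m n)) \<or> measure_pmf.prob W {k. even k} > 0"
  shows "(\<lambda>n. ln (return_prob n (Wn n) (m n)) / real n) \<longlonglongrightarrow> ln (growth W \<alpha>)"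
proof (rule order_tendstoI)
  let ?G = "growth W \<alpha>"
  let ?P = "\<lambda>n. return_prob n (Wn n) (m n)"
  have G: "1/2 \<le> ?G" by (rule growth_ge_half[OF \<alpha>])
  have lower: "\<exists>c>0. eventually (\<lambda>n. c / real (n + 1) * (?G - \<eta>) ^ n \<le> ?P n) sequentially"
    if "0 < \<eta>" "\<eta> \<le> 1/4" for \<eta>
    using eventually_return_prob_ge[OF W_pos conv m_pos \<alpha> m_lim parity that] by metis
  \<comment> \<open>Positivity has to be known before logarithms are compared; \<eta> = 1/4 leaves a
    base of at least 1/4.\<close>
  have pos: "eventually (\<lambda>n. 0 < ?P n) sequentially"
  proof -
    obtain c where c: "c > 0" "eventually (\<lambda>n. c / real (n + 1) * (?G - 1/4) ^ n \<le> ?P n) sequentially"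
      using lower[of "1/4"] by auto
    from c(2) show ?thesis
    proof eventually_elim
      case (elim n)
      have "0 < c / real (n + 1) * (?G - 1/4) ^ n" using c(1) G by simp
      then show ?case using elim by linarith
    qed
  qed
  have root: "((\<lambda>\<eta>. ln (?G + \<eta>)) \<longlongrightarrow> ln (?G + 0)) (at_right 0)" "((\<lambda>\<eta>. ln (?G - \<eta>)) \<longlongrightarrow> ln (?G - 0)) (at_right 0)"
    using G by (intro tendsto_intros; simp)+
  {
    fix u assume "ln ?G < u"
    then have "eventually (\<lambda>\<eta>. ln (?G + \<eta>) < u) (at_right 0)"
      by (intro order_tendstoD(2)[OF root(1)]) simp
    moreover have "eventually (\<lambda>\<eta>::real. 0 < \<eta>) (at_right 0)" by (rule eventually_at_right_less)
    ultimately have "eventually (\<lambda>\<eta>. ln (?G + \<eta>) < u \<and> 0 < \<eta>) (at_right 0)" by (rule eventually_conj)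
    then obtain \<eta> where \<eta>: "ln (?G + \<eta>) < u" "0 < \<eta>"
      using eventually_happens[of _ "at_right (0::real)"] by (auto simp: trivial_limit_at_right_real)
    \<comment> \<open>The polynomial factor costs ln(n + 1)/n, which vanishes in the limit; the
      lower bound uses the same fact.\<close>
    have "(\<lambda>n. ln (real n + 1) / real n + ln (?G + \<eta>)) \<longlonglongrightarrow> 0 + ln (?G + \<eta>)"
      by (intro tendsto_add tendsto_const) real_asymp
    then have "eventually (\<lambda>n. ln (real n + 1) / real n + ln (?G + \<eta>) < u) sequentially"
      using \<eta>(1) by (intro order_tendstoD(2)) auto
    moreover have "eventually (\<lambda>n. ?P n \<le> real (n + 1) * (?G + \<eta>) ^ n) sequentially"
      by (rule eventually_return_prob_le[OF conv _ \<alpha> m_lim \<eta>(2)]) (rule m_pos)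
    ultimately show "eventually (\<lambda>n. ln (?P n) / real n < u) sequentially"
      using pos eventually_ge_at_top[of 1]
    proof eventually_elim
      case (elim n)
      have Gn: "0 < (?G + \<eta>) ^ n" using G \<eta> by simp
      have "ln (?P n) \<le> ln (real (n + 1) * (?G + \<eta>) ^ n)"
        using elim(2,3) Gn by (subst ln_le_cancel_iff) auto
      also have "\<dots> = ln (real n + 1) + real n * ln (?G + \<eta>)"
        using G \<eta> Gn by (subst ln_mult_pos) (auto simp: ln_realpow add.commute)
      finally have "ln (?P n) / real n \<le> (ln (real n + 1) + real n * ln (?G + \<eta>)) / real n"
        by (rule divide_right_mono) simp
      then show ?case using elim(1,4) by (simp add: add_divide_distrib)
    qed
  next
    fix l assume "l < ln ?G"
    then have "eventually (\<lambda>\<eta>. l < ln (?G - \<eta>)) (at_right 0)"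
      by (intro order_tendstoD(1)[OF root(2)]) simp
    moreover have "eventually (\<lambda>\<eta>::real. \<eta> \<in> {0<..<1/4}) (at_right 0)"
      by (rule eventually_at_right_real) simp
    ultimately have "eventually (\<lambda>\<eta>. l < ln (?G - \<eta>) \<and> \<eta> \<in> {0<..<1/4}) (at_right 0)" by (rule eventually_conj)
    then obtain \<eta> where \<eta>: "l < ln (?G - \<eta>)" "0 < \<eta>" "\<eta> < 1/4"
      using eventually_happens[of _ "at_right (0::real)"] by (auto simp: trivial_limit_at_right_real)
    obtain c where c: "c > 0" and ev: "eventually (\<lambda>n. c / real (n + 1) * (?G - \<eta>) ^ n \<le> ?P n) sequentially"
      using lower[of \<eta>] \<eta> by auto
    have "(\<lambda>n. ln c / real n - ln (real n + 1) / real n + ln (?G - \<eta>)) \<longlonglongrightarrow> 0 - 0 + ln (?G - \<eta>)"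
      by (intro tendsto_add tendsto_diff tendsto_const) real_asymp+
    then have "eventually (\<lambda>n. l < ln c / real n - ln (real n + 1) / real n + ln (?G - \<eta>)) sequentially"
      using \<eta>(1) by (intro order_tendstoD(1)) auto
    then show "eventually (\<lambda>n. l < ln (?P n) / real n) sequentially"
      using ev eventually_ge_at_top[of 1]
    proof eventually_elim
      case (elim n)
      have Gn: "0 < (?G - \<eta>) ^ n" using G \<eta> by simp
      have "ln c - ln (real n + 1) + real n * ln (?G - \<eta>) = ln (c / real (n + 1) * (?G - \<eta>) ^ n)"
        using G \<eta> c Gn by (subst ln_mult_pos) (auto simp: ln_realpow ln_div add.commute)
      also have "\<dots> \<le> ln (?P n)"
        using elim(2) c Gn by (intro ln_mono) auto
      finally have "(ln c - ln (real n + 1) + real n * ln (?G - \<eta>)) / real n \<le> ln (?P n) / real n"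
        by (rule divide_right_mono) simp
      then show ?case using elim(1,3) by (simp add: add_divide_distrib diff_divide_distrib)
    qed
  }
qed

theorem theorem2p5:
  fixes W :: "nat pmf"
    and Wn :: "nat \<Rightarrow> nat pmf"
    and M :: "nat \<Rightarrow> 'a measure"
    and X :: "nat \<Rightarrow> nat \<Rightarrow> 'a \<Rightarrow> nat \<Rightarrow> nat"
    and m :: "nat \<Rightarrow> nat"
    and \<alpha> :: real
  assumes W_pos: "set_pmf W \<subseteq> {1..}"
    and Wn_range: "\<And>n. n \<ge> 1 \<Longrightarrow> set_pmf (Wn n) \<subseteq> {1..n}"
    and Wn_conv: "weak_conv_m (\<lambda>n. distr (measure_pmf (Wn n)) borel real)
                    (distr (measure_pmf W) borel real)"
    and X_iid: "\<And>n. n \<ge> 1 \<Longrightarrow> iid_weighted_vectors n (Wn n) (M n) (X n)"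
    and m_pos: "\<And>n. n \<ge> 1 \<Longrightarrow> m n \<ge> 1"
    and \<alpha>_pos: "\<alpha> > 0"
    and m_lim: "(\<lambda>n. real (m n) / real n) \<longlonglongrightarrow> \<alpha>"
    and parity: "(\<forall>n\<ge>1. even (m n)) \<or> measure_pmf.prob W {k. even k} > 0"
  shows "((\<lambda>n. ln (measure (M n) (zero_sum_event n (m n) (M n) (X n))) / real n)
            \<longlonglongrightarrow> - rate W \<alpha>) \<and>
         (\<forall>a>0. rate W a > 0) \<and>
         continuous_on {0<..} (rate W) \<and>
         mono_on {0<..} (rate W)"
proof (intro conjI allI impI)
  \<comment> \<open>The vectors are specified only for n \<ge> 1, so the two sequences are
    identified eventually rather than everywhere.\<close>
  have "eventually (\<lambda>n. ln (return_prob n (Wn n) (m n)) / real n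
      = ln (measure (M n) (zero_sum_event n (m n) (M n) (X n))) / real n) sequentially"
    using eventually_ge_at_top[of 1]
    by eventually_elim (simp add: prob_zero_sum_event[OF X_iid] return_prob_def)
  moreover have "(\<lambda>n. ln (return_prob n (Wn n) (m n)) / real n) \<longlonglongrightarrow> ln (growth W \<alpha>)"
    by (rule return_prob_limit[OF W_pos Wn_conv _ \<alpha>_pos m_lim parity]) (rule m_pos)
  ultimately show "(\<lambda>n. ln (measure (M n) (zero_sum_event n (m n) (M n) (X n))) / real n) \<longlonglongrightarrow> - rate W \<alpha>"
    unfolding rate_eq_growth[OF \<alpha>_pos] minus_minus by (rule Lim_transform_eventually[rotated])
qed (use rate_pos[OF W_pos] continuous_on_rate mono_on_rate in auto)

end
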